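(* Let $\alpha\in\mathbb{R}$, $\sigma>0$, $\beta:=\alpha-1$, and let $X_{t+1}=\alpha X_t+\sigma\varepsilon_{t+1}$, $t\ge 0$, where $(\varepsilon_t)_{t\ge1}$ are i.i.d. standard Gaussian random variables independent of the real-valued random variable $X_0$. Let $U(x)=-e^{-x}$, and let $\Phi$, $\Phi_0$, $L_T^\phi$ (with initial capital $L_0=0$) be as defined in the context. Let $T\ge 1$ be an integer, and for $1\le t\le T$ and $z\in\mathbb{R}$ set $$\theta_t^T:=1-(T-t)\beta,\qquad \hat\phi_t^T(z):=\frac{\beta z}{\sigma^2}\,\theta_t^T .$$ Define $\gamma_\beta(T):=\dfrac{\beta^{2T}\,\Gamma\left(\frac{1}{\beta^2}+T\right)}{\Gamma\left(\frac1{\beta^2}\right)}$ if $\beta\ne0$ and $\gamma_\beta(T):=1$ if $\beta=0$, where $\Gamma(x)=\int_0^{+\infty}t^{x-1}e^{-t}\,\mathrm{d}t$. Then the following hold. 1. The strategy $(\phi_t^* )_{1\le t\le T}:=(\hat\phi_t^T(X_{t-1}))_{1\le t\le T}$ is optimal when past information is used, i.e. $\sup_{\phi\in\Phi}\mathbb{E}\,U(L_T^\phi)=\mathbb{E}\,U(L_T^{\phi^*})$, and the strategy $(\eta_t^* )_{1\le t\le T}:=(\hat\phi_t^T(X_0))_{1\le t\le T}$ is optimal when past information is ignored, i.e. $\eta^*\in\Phi_0$ and $\sup_{\phi\in\Phi_0}\mathbb{E}\,U(L_T^\phi)=\mathbb{E}\,U(L_T^{\eta^*})$. 2. The maximal conditional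 expected utilities given $X_0=z$ (over $\Phi$ and over $\Phi_0$, respectively) are attained by these strategies and are given by $$\mathbb{E}\left[U(L_T^{\phi^*})\,|\,X_0=z\right]=-\frac{1}{\sqrt{\gamma_\beta(T)}}\,e^{-\frac{\beta^2z^2}{2\sigma^2}T}\qquad\text{and}\qquad \mathbb{E}\left[U(L_T^{\eta^*})\,|\,X_0=z\right]=-e^{-\frac{\beta^2z^2}{2\sigma^2}T}.$$ 3. If the autoregressive process is stable, that is, $|\alpha|<1$ (equivalently $\beta\in(-2,0)$), and if moreover $X_0$ is $N(0,1)$-distributed and $\mathrm{var}(X_t)=1$ for all $t\ge0$, then the maximal expected utilities over $\Phi$ and over $\Phi_0$ are, respectively, $$\mathbb{E}\left[U(L_T^{\phi^*})\right]=-\sqrt{\frac{\beta+2}{(2-(T-1)\beta)\,\gamma_\beta(T)}}\qquad\text{and}\qquad \mathbb{E}\left[U(L_T^{\eta^*})\right]=-\sqrt{\frac{\beta+2}{2-(T-1)\beta}} .$$ 4. One has $\displaystyle\lim_{T\to+\infty}\frac{\gamma_\beta(T)}{h_\beta(T)}=1$, where $$h_\beta(T)=\frac{1}{\Gamma\left(\frac1{\beta^2}\right)}\left(\beta^2\right)^{1-\frac1{\beta^2}}\sqrt{2\pi\left(T-1+\frac1{\beta^2}\right)}\left(\frac{1+(T-1)\beta^2}{e}\right)^{T-1+\frac1{\beta^2}}\quad\text{if }\beta\neq0,$$ and $h_\beta(T)=1$ if $\beta=0$.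
   Context: The market has a riskless asset of constant price $1$ and one risky asset with price process $(X_t)_{t\ge0}$. The information flow is $\mathcal{F}_t:=\sigma(X_s,\,0\le s\le t)$. A trading strategy is an $\mathbb{R}$-valued process $\phi=(\phi_t)_{t\ge1}$ such that $\phi_t$ is $\mathcal{F}_{t-1}$-measurable for every $t\geq 1$; $\Phi$ denotes the set of all trading strategies. $\Phi_0\subset\Phi$ denotes the set of trading strategies for which $\phi_t$ is $\mathcal{F}_0$-measurable for all $1\le t\le T$. Only the components $\phi_1,\dots,\phi_T$ matter for horizon $T$. The terminal wealth, with initial capital $L_0=0$, is $$L_T^\phi=\sum_{j=1}^T\phi_j(X_j-X_{j-1}).$$ Since $U\le 0$, expectations $\mathbb{E}\,U(L_T^\phi)$ always exist but may equal $-\infty$. Conditional expectations given $X_0=z$ are understood for almost every $z$ with respect to the law of $X_0$; "maximal conditional expected utility attained by $\phi^*$ over $\Phi$" means $\mathbb{E}[U(L_T^\phi)|X_0]\le\mathbb{E}[U(L_T^{\phi^*})|X_0]$ almost surely for all $\phi\in\Phi$ (and similarly for $\eta^*$ and $\Phi_0$). *)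

theory Defs
  imports "HOL-Probability.Probability"
begin

definition natural_filtration ::
  "'a measure \<Rightarrow> (nat \<Rightarrow> 'a \<Rightarrow> real) \<Rightarrow> nat \<Rightarrow> 'a measure" where
  "natural_filtration M X t =
     sigma (space M) (\<Union>s\<in>{0..t}. {X s -` A \<inter> space M | A. A \<in> sets borel})"

(* Strategies are indexed by t >= 1; the value of phi at 0 is irrelevant and unconstrained. *)
definition strategies ::
  "'a measure \<Rightarrow> (nat \<Rightarrow> 'a \<Rightarrow> real) \<Rightarrow> (nat \<Rightarrow> 'a \<Rightarrow> real) set" where
  "strategies M X =
     {\<phi>. \<forall>t\<ge>1. \<phi> t \<in> borel_measurable (natural_filtration M X (t - 1))}"

definition strategies0 ::
  "'a measure \<Rightarrow> (nat \<Rightarrow> 'a \<Rightarrow> real) \<Rightarrow> nat \<Rightarrow> (nat \<Rightarrow> 'a \<Rightarrow> real) set" where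
  "strategies0 M X T =
     {\<phi> \<in> strategies M X.
        \<forall>t. 1 \<le> t \<and> t \<le> T \<longrightarrow> \<phi> t \<in> borel_measurable (natural_filtration M X 0)}"

definition wealth ::
  "(nat \<Rightarrow> 'a \<Rightarrow> real) \<Rightarrow> nat \<Rightarrow> (nat \<Rightarrow> 'a \<Rightarrow> real) \<Rightarrow> 'a \<Rightarrow> real" where
  "wealth X T \<phi> \<omega> = (\<Sum>j=1..T. \<phi> j \<omega> * (X j \<omega> - X (j - 1) \<omega>))"

definition U :: "real \<Rightarrow> real" where
  "U x = - exp (- x)"

(* Extended-real expectation: positive part minus negative part.  The Bochner integral would
   assign 0 to a non-integrable utility, where the value wanted is minus infinity. *)
definition ext_expectation :: "'a measure \<Rightarrow> ('a \<Rightarrow> real) \<Rightarrow> ereal" where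
  "ext_expectation M Y =
     enn2ereal (\<integral>\<^sup>+\<omega>. ennreal (Y \<omega>) \<partial>M) - enn2ereal (\<integral>\<^sup>+\<omega>. ennreal (- Y \<omega>) \<partial>M)"

(* E[Y | Z] as a random variable, likewise extended-real valued. *)
definition ext_cond_exp ::
  "'a measure \<Rightarrow> ('a \<Rightarrow> real) \<Rightarrow> ('a \<Rightarrow> real) \<Rightarrow> 'a \<Rightarrow> ereal" where
  "ext_cond_exp M Z Y \<omega> =
     enn2ereal (nn_cond_exp M (vimage_algebra (space M) Z borel) (\<lambda>\<omega>. ennreal (Y \<omega>)) \<omega>)
   - enn2ereal (nn_cond_exp M (vimage_algebra (space M) Z borel) (\<lambda>\<omega>. ennreal (- Y \<omega>)) \<omega>)"

(* E[Y | Z = z]: a Borel function g of z with g(Z) = E[Y | Z] almost surely.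
   It is determined only up to null sets of the law of Z. *)
definition ext_cond_exp_at ::
  "'a measure \<Rightarrow> ('a \<Rightarrow> real) \<Rightarrow> ('a \<Rightarrow> real) \<Rightarrow> real \<Rightarrow> ereal" where
  "ext_cond_exp_at M Z Y =
     (SOME g. g \<in> borel_measurable borel \<and> (AE \<omega> in M. g (Z \<omega>) = ext_cond_exp M Z Y \<omega>))"

definition theta :: "real \<Rightarrow> nat \<Rightarrow> nat \<Rightarrow> real" where
  "theta \<beta> T t = 1 - (real T - real t) * \<beta>"

definition phi_hat :: "real \<Rightarrow> real \<Rightarrow> nat \<Rightarrow> nat \<Rightarrow> real \<Rightarrow> real" where
  "phi_hat \<beta> \<sigma> T t z = \<beta> * z / \<sigma>\<^sup>2 * theta \<beta> T t"

(* The same formulas are used beyond the horizon T, where the strategy does not affect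
   the wealth at T. *)
definition phi_star ::
  "real \<Rightarrow> real \<Rightarrow> (nat \<Rightarrow> 'a \<Rightarrow> real) \<Rightarrow> nat \<Rightarrow> nat \<Rightarrow> 'a \<Rightarrow> real" where
  "phi_star \<beta> \<sigma> X T t \<omega> = phi_hat \<beta> \<sigma> T t (X (t - 1) \<omega>)"

definition eta_star ::
  "real \<Rightarrow> real \<Rightarrow> (nat \<Rightarrow> 'a \<Rightarrow> real) \<Rightarrow> nat \<Rightarrow> nat \<Rightarrow> 'a \<Rightarrow> real" where
  "eta_star \<beta> \<sigma> X T t \<omega> = phi_hat \<beta> \<sigma> T t (X 0 \<omega>)"

definition gamma_beta :: "real \<Rightarrow> nat \<Rightarrow> real" where
  "gamma_beta \<beta> T =
     (if \<beta> = 0 then 1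
      else \<beta> ^ (2 * T) * Gamma (1 / \<beta>\<^sup>2 + real T) / Gamma (1 / \<beta>\<^sup>2))"

definition h_beta :: "real \<Rightarrow> nat \<Rightarrow> real" where
  "h_beta \<beta> T =
     (if \<beta> = 0 then 1
      else 1 / Gamma (1 / \<beta>\<^sup>2) * (\<beta>\<^sup>2) powr (1 - 1 / \<beta>\<^sup>2)
           * sqrt (2 * pi * (real T - 1 + 1 / \<beta>\<^sup>2))
           * ((1 + (real T - 1) * \<beta>\<^sup>2) / exp 1) powr (real T - 1 + 1 / \<beta>\<^sup>2))"

end

theory Submission
  imports Defs "HOL-Real_Asymp.Real_Asymp"
begin

text \<open>
  For \<open>U x = - exp (- x)\<close>, maximising expected utility means minimising the expectation of
  \<open>exp (- wealth)\<close>, a nonnegative quantity, so the optimisation runs through nonnegative integrals,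
  where no integrability has to be checked. Each increment \<open>X (t+1) - X t = \<beta> X t + \<sigma> \<epsilon> (t+1)\<close> is,
  given the past, Gaussian with a known mean, because \<open>\<epsilon> (t+1)\<close> is independent of the history up to
  \<open>t\<close>. Integrating out the newest innovation (\<open>nn_integral_exp_next\<close>) therefore turns an exponential
  of a quadratic form in \<open>X (t+1)\<close> into an exponential of a quadratic form in \<open>X t\<close>.

  Both optimisation problems are solved by completing a square. A process \<open>W\<close> is exhibited with
  \<open>W T = exp (- wealth)\<close> and minus the claimed value as \<open>W 0\<close>, such that the conditional expectation
  of \<open>W (t+1)\<close> given the past up to \<open>t\<close> is \<open>W t\<close> times the exponential of a nonnegative multiple of
  a square. Hence the expectation of \<open>W\<close> never decreases in time, whatever the strategy, and it is
  constant for a strategy that makes every square vanish.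

  When past prices may be used (\<open>past_info_step\<close>), \<open>W t\<close> is the product of
  \<open>exp (- wealth up to t)\<close> and the dynamic-programming value
  \<open>c (T-t) exp (- \<beta>^2 (T-t) (X t)^2 / (2 \<sigma>^2))\<close>; the square vanishes at \<open>phi_star\<close>. Each Gaussian
  integration contributes a factor \<open>1 / sqrt (1 + k \<beta>^2)\<close>, and their product is
  \<open>1 / sqrt (gamma_beta \<beta> T)\<close>.

  When only \<open>X 0\<close> may be used (\<open>initial_info_step\<close>), the future positions are known, so the future
  gains have the conditional mean \<open>\<beta> R t X t\<close> with \<open>R t\<close> the sum of the future positions weighted
  by powers of \<open>\<alpha>\<close>. The wealth is then linear in the innovations with coefficients
  \<open>\<sigma> (\<phi> (t+1) + \<beta> R (t+1))\<close>, and each of them is optimised separately. The optimal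
  coefficients coincide, \<open>eta_star\<close> realises them, and each period then multiplies the expected
  disutility by \<open>exp (- \<beta>^2 (X 0)^2 / (2 \<sigma>^2))\<close>.

  The bounds hold with an arbitrary nonnegative function of the initial information as a weight.
  This single fact yields the unconditional suprema (weight one) and the conditional statements
  (weights that are indicators), see the locale \<open>attained_value\<close>. For the stationary start the two
  values are integrated against the standard normal law, where unit variance forces
  \<open>\<sigma>^2 = - \<beta> (\<beta> + 2)\<close>.

  The asymptotics of \<open>gamma_beta\<close> are Stirling's formula at the points \<open>1/\<beta>^2 + n\<close>. It is derived
  for factorials from the Wallis product and carried over to the shifted arguments by the limit
  representation of the Gamma function.
\<close>

section \<open>Stirling's formula\<close>

text \<open>
  The logarithmic error \<open>d\<close> of the approximation has increments of order \<open>1/n^2\<close>, hence converges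
  to some \<open>L\<close>; the factorials in the Wallis product for \<open>pi/2\<close> then force \<open>exp L = sqrt (2 pi)\<close>.
\<close>
lemma stirling_fact:
  "(\<lambda>n. fact n / (sqrt (2 * pi * real n) * (real n powr real n / exp (real n)))) \<longlonglongrightarrow> (1::real)"
proof -
  define d where "d = (\<lambda>n. ln (fact n) - (real n + 1/2) * ln (real n) + real n)"
  define \<delta> where "\<delta> = (\<lambda>n. 1 - (real n + 1/2) * (ln (real n + 1) - ln (real n)))"
  have step: "d (Suc n) - d n = \<delta> n" if "n \<ge> 1" for n
  proof -
    have "ln (fact (Suc n)) = ln (real n + 1) + ln (fact n)"
      unfolding fact_Suc by (subst ln_mult) (auto simp: add.commute)
    thus ?thesis
      by (simp add: d_def \<delta>_def algebra_simps del: fact_Suc)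
  qed
  have "\<delta> \<in> O(\<lambda>n. 1 / real n ^ 2)"
    unfolding \<delta>_def by real_asymp
  moreover have "summable (\<lambda>n. norm (1 / real n ^ 2))"
    using inverse_power_summable[of 2, where 'a = real] by (simp add: field_simps)
  ultimately have "summable \<delta>"
    by (rule summable_comparison_test_bigo[rotated])
  hence "summable (\<lambda>n. \<delta> (Suc n))"
    by (simp add: summable_Suc_iff)
  hence "summable (\<lambda>n. d (Suc (Suc n)) - d (Suc n))"
    by (simp add: step)
  hence "convergent (\<lambda>n. \<Sum>k<n. d (Suc (Suc k)) - d (Suc k))"
    by (simp add: summable_iff_convergent)
  hence "convergent (\<lambda>n. d (Suc n) - d 1)"
    by (subst (asm) sum_lessThan_telescope) simp
  then obtain l where "(\<lambda>n. d (Suc n) - d 1) \<longlonglongrightarrow> l"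
    by (auto simp: convergent_def)
  from tendsto_add[OF this tendsto_const[of "d 1"]] have "(\<lambda>n. d (Suc n)) \<longlonglongrightarrow> l + d 1"
    by simp
  then obtain L where L: "d \<longlonglongrightarrow> L"
    by (auto simp: filterlim_sequentially_Suc)
  have fact_d: "fact n = exp (d n) * exp ((real n + 1/2) * ln (real n) - real n)" if "n \<ge> 1" for n
    by (simp add: d_def flip: exp_add)
  have wallis_prod: "(\<Prod>k=1..n. (4 * real k ^ 2) / (4 * real k ^ 2 - 1))
      = (2 ^ (2 * n) * fact n ^ 2) ^ 2 / (fact (2 * n) ^ 2 * (2 * real n + 1))" for n
  proof (induction n)
    case (Suc n)
    have split: "4 * real (Suc n) ^ 2 - 1 = (2 * real n + 1) * (2 * real n + 3)"
      by (simp add: power2_eq_square algebra_simps)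
    have fact2: "fact (2 * Suc n) = (2 * (real n + 1)) * (2 * real n + 1) * fact (2 * n)"
      by (simp add: algebra_simps)
    have pow2: "2 ^ (2 * Suc n) * fact (Suc n) ^ 2 = 4 * (real n + 1) ^ 2 * (2 ^ (2 * n) * fact n ^ 2)"
      by (simp add: power_mult_distrib add.commute)
    have frac: "A ^ 2 / (B ^ 2 * u) * ((4 * m ^ 2) / (u * v)) = (4 * m ^ 2 * A) ^ 2 / ((2 * m * u * B) ^ 2 * v)"
      if "u \<noteq> 0" "v \<noteq> 0" "m \<noteq> 0" "B \<noteq> 0" for A B u v m :: real
      using that by (simp add: field_simps power2_eq_square)
    have "(\<Prod>k=1..Suc n. (4 * real k ^ 2) / (4 * real k ^ 2 - 1))
      = (2 ^ (2 * n) * fact n ^ 2) ^ 2 / (fact (2 * n) ^ 2 * (2 * real n + 1)) *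
        ((4 * (real n + 1) ^ 2) / ((2 * real n + 1) * (2 * real n + 3)))"
      using Suc.IH split by (simp add: add.commute)
    also have "\<dots> = (4 * (real n + 1) ^ 2 * (2 ^ (2 * n) * fact n ^ 2)) ^ 2 /
        ((2 * (real n + 1) * (2 * real n + 1) * fact (2 * n)) ^ 2 * (2 * real n + 3))"
      by (rule frac) (auto simp: add_nonneg_eq_0_iff)
    also have "2 * real n + 3 = 2 * real (Suc n) + 1"
      by simp
    finally show ?case
      unfolding fact2 pow2 .
  qed auto
  \<comment> \<open>In the Wallis product the combination 4 d n - 2 d (2n) survives, whose limit is 2 L;
  the powers of n and e cancel up to the rational factor on the right.\<close>
  have wallis_d: "(\<Prod>k=1..n. (4 * real k ^ 2) / (4 * real k ^ 2 - 1))
      = exp (4 * d n - 2 * d (2 * n)) * (real n / (2 * (2 * real n + 1)))" if "n \<ge> 1" for n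
  proof -
    have n: "real n > 0" using that by simp
    have "ln (2 * real n) = ln 2 + ln (real n)"
      using n by (simp add: ln_mult)
    hence "4 * d n - 2 * d (2 * n) =
        4 * ln (fact n) - 2 * ln (fact (2 * n)) + 4 * real n * ln 2 + ln 2 - ln (real n)"
      by (simp add: d_def field_simps)
    moreover have "exp (4 * ln (fact n :: real)) = fact n ^ 4"
      using exp_of_nat_mult[of 4 "ln (fact n :: real)"] by simp
    moreover have "exp (2 * ln (fact (2 * n) :: real)) = fact (2 * n) ^ 2"
      using exp_of_nat_mult[of 2 "ln (fact (2 * n) :: real)"] by simp
    moreover have "exp (4 * real n * ln 2) = 2 ^ (4 * n)"
      using exp_of_nat_mult[of "4 * n" "ln (2 :: real)"] by simp
    ultimately have e: "exp (4 * d n - 2 * d (2 * n)) =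
        fact n ^ 4 / fact (2 * n) ^ 2 * 2 ^ (4 * n) * 2 / real n"
      using n by (simp only: exp_add exp_diff exp_ln)
    have "(2 ^ (2 * n) * fact n ^ 2) ^ 2 = (2::real) ^ (4 * n) * fact n ^ 4"
      by (simp add: power_mult_distrib mult.commute flip: power_mult)
    thus ?thesis
      unfolding wallis_prod e using n by (simp del: distrib_left_numeral)
  qed
  have "(\<lambda>n. exp (4 * d n - 2 * d (2 * n)) * (real n / (2 * (2 * real n + 1))))
          \<longlonglongrightarrow> exp (4 * L - 2 * L) * (1 / 4)"
  proof (intro tendsto_mult tendsto_exp tendsto_diff tendsto_const L)
    show "(\<lambda>n. d (2 * n)) \<longlonglongrightarrow> L"
      by (rule filterlim_compose[OF L]) real_asymp
    show "(\<lambda>n. real n / (2 * (2 * real n + 1))) \<longlonglongrightarrow> 1 / 4"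
      by real_asymp
  qed
  moreover have "(\<lambda>n. exp (4 * d n - 2 * d (2 * n)) * (real n / (2 * (2 * real n + 1))))
          \<longlonglongrightarrow> pi / 2"
    by (rule Lim_transform_eventually[OF wallis])
       (intro eventually_mono[OF eventually_ge_at_top[of 1]] wallis_d)
  ultimately have "exp (2 * L) / 4 = pi / 2"
    using LIMSEQ_unique by fastforce
  hence "exp L ^ 2 = 2 * pi"
    by (simp flip: exp_double)
  hence eL: "exp L = sqrt (2 * pi)"
    by (metis exp_ge_zero real_sqrt_unique)
  have "(\<lambda>n. exp (d n) / sqrt (2 * pi)) \<longlonglongrightarrow> exp L / sqrt (2 * pi)"
    by (intro tendsto_intros L) auto
  hence "(\<lambda>n. exp (d n) / sqrt (2 * pi)) \<longlonglongrightarrow> 1"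
    by (simp add: eL)
  thus ?thesis
  proof (rule Lim_transform_eventually)
    show "\<forall>\<^sub>F n in sequentially. exp (d n) / sqrt (2 * pi) =
            fact n / (sqrt (2 * pi * real n) * (real n powr real n / exp (real n)))"
      using eventually_ge_at_top[of 1]
    proof eventually_elim
      case (elim n)
      have "exp ((real n + 1/2) * ln (real n) - real n) = sqrt (real n) * (real n powr real n / exp (real n))"
        using elim by (simp add: powr_def exp_add exp_diff algebra_simps flip: powr_half_sqrt)
      thus ?case
        using elim by (simp add: fact_d real_sqrt_mult)
    qed
  qed
qed

text \<open>
  By Euler's limit for \<open>Gamma b\<close> the rising factorial behaves like \<open>fact (n - 1) * n powr b / Gamma b\<close>,
  so the formula for factorials applies; replacing the argument \<open>n\<close> by \<open>n - 1 + b\<close> in Stirling's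
  expression multiplies it by \<open>n powr (b - 1)\<close> asymptotically.
\<close>
lemma pochhammer_stirling:
  fixes b :: real
  assumes "b > 0"
  shows "(\<lambda>n. pochhammer b n * Gamma b /
      (sqrt (2 * pi * (real n - 1 + b)) * ((real n - 1 + b) powr (real n - 1 + b) / exp (real n - 1 + b)))) \<longlonglongrightarrow> 1"
proof -
  have "Gamma b \<noteq> 0"
    using Gamma_real_pos[OF assms] by simp
  have "(\<lambda>n. Gamma b / Gamma_series' b n *
      (fact n / (sqrt (2 * pi * real n) * (real n powr real n / exp (real n)))) *
      (sqrt (2 * pi * real n) * (real n powr real n / exp (real n)) * real n powr (b - 1) /
      (sqrt (2 * pi * (real n - 1 + b)) * ((real n - 1 + b) powr (real n - 1 + b) / exp (real n - 1 + b)))))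
      \<longlonglongrightarrow> Gamma b / Gamma b * 1 * 1"
  proof (intro tendsto_intros stirling_fact Gamma_series'_LIMSEQ)
    show "(\<lambda>n. sqrt (2 * pi * real n) * (real n powr real n / exp (real n)) * real n powr (b - 1) /
      (sqrt (2 * pi * (real n - 1 + b)) * ((real n - 1 + b) powr (real n - 1 + b) / exp (real n - 1 + b))))
      \<longlonglongrightarrow> 1"
      using assms by real_asymp
  qed fact
  hence "(\<lambda>n. Gamma b / Gamma_series' b n *
      (fact n / (sqrt (2 * pi * real n) * (real n powr real n / exp (real n)))) *
      (sqrt (2 * pi * real n) * (real n powr real n / exp (real n)) * real n powr (b - 1) /
      (sqrt (2 * pi * (real n - 1 + b)) * ((real n - 1 + b) powr (real n - 1 + b) / exp (real n - 1 + b)))))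
      \<longlonglongrightarrow> 1"
    using \<open>Gamma b \<noteq> 0\<close> by simp
  thus ?thesis
  proof (rule Lim_transform_eventually)
    show "\<forall>\<^sub>F n in sequentially. Gamma b / Gamma_series' b n *
      (fact n / (sqrt (2 * pi * real n) * (real n powr real n / exp (real n)))) *
      (sqrt (2 * pi * real n) * (real n powr real n / exp (real n)) * real n powr (b - 1) /
      (sqrt (2 * pi * (real n - 1 + b)) * ((real n - 1 + b) powr (real n - 1 + b) / exp (real n - 1 + b)))) =
      pochhammer b n * Gamma b /
      (sqrt (2 * pi * (real n - 1 + b)) * ((real n - 1 + b) powr (real n - 1 + b) / exp (real n - 1 + b)))"
      using eventually_gt_at_top[of 0]
    proof eventually_elim
      case (elim n)
      have "fact n = real n * fact (n - 1)"
        using elim by (simp add: fact_reduce)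
      moreover have "real n powr (b - 1) = real n powr b / real n"
        using elim by (simp add: powr_diff)
      moreover have "exp (b * ln (real n)) = real n powr b"
        using elim by (simp add: powr_def)
      moreover have "pochhammer b n \<noteq> 0"
        using assms pochhammer_pos[of b n] by simp
      ultimately show ?case
        using elim by (simp add: Gamma_series'_def)
    qed
  qed
qed

section \<open>The normalising constant of the optimal value\<close>

text \<open>
  In product form the constant is a product of the normalising factors of successive Gaussian
  integrations, and the case \<open>\<beta> = 0\<close> is no exception.
\<close>
lemma gamma_beta_prod: "gamma_beta \<beta> n = (\<Prod>k<n. 1 + real k * \<beta>\<^sup>2)"
proof (cases "\<beta> = 0")
  case False
  hence b: "1 / \<beta>\<^sup>2 > 0" by simp
  hence "1 / \<beta>\<^sup>2 \<notin> \<int>\<^sub>\<le>\<^sub>0"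
    by (auto dest: nonpos_Ints_nonpos)
  hence "gamma_beta \<beta> n = \<beta> ^ (2 * n) * pochhammer (1 / \<beta>\<^sup>2) n"
    using False by (simp add: gamma_beta_def pochhammer_Gamma)
  also have "\<dots> = (\<Prod>k<n. \<beta>\<^sup>2 * (1 / \<beta>\<^sup>2 + real k))"
    by (simp add: pochhammer_prod prod.distrib power_mult atLeast0LessThan)
  also have "\<dots> = (\<Prod>k<n. 1 + real k * \<beta>\<^sup>2)"
    using False by (intro prod.cong) (auto simp: field_simps)
  finally show ?thesis .
qed (simp add: gamma_beta_def)

text \<open>
  With \<open>b = 1/\<beta>^2\<close> the quotient is Stirling's quotient for \<open>pochhammer b n\<close>: the powers of \<open>\<beta>^2\<close>
  hidden in \<open>(1 + (n - 1) \<beta>^2) powr (n - 1 + b)\<close> combine with \<open>\<beta>^2 powr (1 - b)\<close> to \<open>\<beta> ^ (2 n)\<close>.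
\<close>
lemma gamma_beta_asymptotics: "(\<lambda>n. gamma_beta \<beta> n / h_beta \<beta> n) \<longlonglongrightarrow> 1"
proof (cases "\<beta> = 0")
  case False
  define b where "b = 1 / \<beta>\<^sup>2"
  have b: "b > 0" and \<beta>2: "\<beta>\<^sup>2 > 0" and b\<beta>: "\<beta>\<^sup>2 * b = 1"
    using False by (simp_all add: b_def)
  from pochhammer_stirling[OF b] show ?thesis
  proof (rule Lim_transform_eventually)
    show "\<forall>\<^sub>F n in sequentially. pochhammer b n * Gamma b /
        (sqrt (2 * pi * (real n - 1 + b)) * ((real n - 1 + b) powr (real n - 1 + b) / exp (real n - 1 + b)))
      = gamma_beta \<beta> n / h_beta \<beta> n"
      using eventually_ge_at_top[of 1]
    proof eventually_elim
      case (elim n)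
      define y where "y = real n - 1 + b"
      have y: "y > 0" using elim b by (simp add: y_def)
      have "(1 + (real n - 1) * \<beta>\<^sup>2) / exp 1 = \<beta>\<^sup>2 * y / exp 1"
        using b\<beta> by (simp add: y_def algebra_simps)
      hence "((1 + (real n - 1) * \<beta>\<^sup>2) / exp 1) powr y = (\<beta>\<^sup>2) powr y * (y powr y / exp y)"
        using y \<beta>2 by (simp add: powr_divide powr_mult exp_powr_real)
      moreover have pow: "(\<beta>\<^sup>2) powr (1 - b) * (\<beta>\<^sup>2) powr y = \<beta> ^ (2 * n)"
        using \<beta>2 by (simp add: y_def powr_realpow power_mult flip: powr_add)
      ultimately have "h_beta \<beta> n = \<beta> ^ (2 * n) * (sqrt (2 * pi * y) * (y powr y / exp y)) / Gamma b"
        using False unfolding h_beta_def b_def[symmetric] y_def[symmetric] pow[symmetric] by (simp add: ac_simps)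
      moreover have "gamma_beta \<beta> n = \<beta> ^ (2 * n) * pochhammer b n"
      proof -
        have "b \<notin> \<int>\<^sub>\<le>\<^sub>0" using b by (auto dest: nonpos_Ints_nonpos)
        thus ?thesis
          using False by (simp add: gamma_beta_def pochhammer_Gamma b_def[symmetric])
      qed
      ultimately show ?case
        using False by (simp add: y_def[symmetric])
    qed
  qed
qed (simp add: gamma_beta_def h_beta_def)

section \<open>Gaussian integrals, independence and conditional expectation\<close>

text \<open>
  Completing the square shows that the integrand is a constant times the normal density with mean
  \<open>- b / (1 + 2 a)\<close> and variance \<open>1 / (1 + 2 a)\<close>.
\<close>
lemma nn_integral_std_normal_exp_quadratic:
  fixes a b c :: real
  assumes "a \<ge> 0"
  shows "(\<integral>\<^sup>+y. ennreal (exp (- (a * y\<^sup>2 + b * y + c))) * ennreal (std_normal_density y) \<partial>lborel)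
    = ennreal (exp (b\<^sup>2 / (2 * (1 + 2 * a)) - c) / sqrt (1 + 2 * a))"
proof -
  define D where "D = 1 + 2 * a"
  have D: "D > 0" using assms by (simp add: D_def)
  define K where "K = exp (b\<^sup>2 / (2 * D) - c) / sqrt D"
  have "exp (- (a * y\<^sup>2 + b * y + c)) * std_normal_density y
      = K * normal_density (- b / D) (1 / sqrt D) y" for y
  proof -
    have "- (a * y\<^sup>2 + b * y + c) - y\<^sup>2 / 2 = (b\<^sup>2 / (2 * D) - c) - (y + b / D)\<^sup>2 * D / 2"
      using D by (simp add: field_simps power2_eq_square) (simp add: D_def algebra_simps)
    hence "exp (- (a * y\<^sup>2 + b * y + c)) * exp (- y\<^sup>2 / 2)
        = exp (b\<^sup>2 / (2 * D) - c) * exp (- ((y + b / D)\<^sup>2 * D / 2))"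
      by (simp flip: exp_add)
    moreover have "K * normal_density (- b / D) (1 / sqrt D) y
        = exp (b\<^sup>2 / (2 * D) - c) * (1 / sqrt (2 * pi)) * exp (- ((y + b / D)\<^sup>2 * D / 2))"
      using D by (simp add: K_def normal_density_def power_divide real_sqrt_divide)
    ultimately show ?thesis
      by (simp add: std_normal_density_def)
  qed
  hence "(\<integral>\<^sup>+y. ennreal (exp (- (a * y\<^sup>2 + b * y + c))) * ennreal (std_normal_density y) \<partial>lborel)
      = (\<integral>\<^sup>+y. ennreal K * ennreal (normal_density (- b / D) (1 / sqrt D) y) \<partial>lborel)"
    using D by (intro nn_integral_cong) (simp add: K_def flip: ennreal_mult)
  also have "\<dots> = ennreal K * (\<integral>\<^sup>+y. ennreal (normal_density (- b / D) (1 / sqrt D) y) \<partial>lborel)"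
    by (rule nn_integral_cmult) simp
  also have "\<dots> = ennreal K"
    using D by (subst nn_integral_eq_integral) simp_all
  finally show ?thesis by (simp add: K_def D_def)
qed

text \<open>
  Conditionally on \<open>F\<close>, a variable independent of \<open>F\<close> may be integrated out with the other
  arguments frozen: the joint law of the identity into \<open>F\<close> and of \<open>Z\<close> is a product measure, so this
  is Tonelli's theorem. Independence is stated for events because the identity and \<open>Z\<close> take
  values in different types.
\<close>
lemma (in prob_space) nn_integral_freeze_independent:
  assumes sub: "subalgebra M F"
    and ind: "\<And>A B. A \<in> sets F \<Longrightarrow> B \<in> sets borel \<Longrightarrow>
      prob (A \<inter> (Z -` B \<inter> space M)) = prob A * prob (Z -` B \<inter> space M)"
    and Z: "distributed M lborel Z f"
    and h: "(\<lambda>(\<omega>, y). h \<omega> y) \<in> borel_measurable (F \<Otimes>\<^sub>M borel)"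
  shows "(\<integral>\<^sup>+\<omega>. h \<omega> (Z \<omega>) \<partial>M) = (\<integral>\<^sup>+\<omega>. (\<integral>\<^sup>+y. h \<omega> y * f y \<partial>lborel) \<partial>M)"
proof -
  have [measurable]: "(\<lambda>\<omega>. \<omega>) \<in> measurable M F" "Z \<in> borel_measurable M"
    using measurable_from_subalg[OF sub measurable_ident_sets[OF refl]]
      distributed_measurable[OF Z] by simp_all
  have f[measurable]: "f \<in> borel_measurable borel"
    using distributed_borel_measurable[OF Z] by simp
  interpret F: prob_space "distr M F (\<lambda>\<omega>. \<omega>)" by (rule prob_space_distr) simp
  interpret Z: prob_space "distr M borel Z" by (rule prob_space_distr) simp
  have spF: "space F = space M" and FM: "sets F \<subseteq> sets M"
    using sub by (auto simp: subalgebra_def)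
  have sets_FZ: "sets (distr M F (\<lambda>\<omega>. \<omega>) \<Otimes>\<^sub>M distr M borel Z) = sets (F \<Otimes>\<^sub>M borel)"
    by (intro sets_pair_measure_cong) simp_all
  have joint: "distr M F (\<lambda>\<omega>. \<omega>) \<Otimes>\<^sub>M distr M borel Z = distr M (F \<Otimes>\<^sub>M borel) (\<lambda>\<omega>. (\<omega>, Z \<omega>))"
  proof (rule pair_measure_eqI)
    fix A B assume "A \<in> sets (distr M F (\<lambda>\<omega>. \<omega>))" "B \<in> sets (distr M borel Z)"
    hence [measurable]: "A \<in> sets F" "B \<in> sets borel" by simp_all
    have "(\<lambda>\<omega>. \<omega>) -` A \<inter> space M = A"
      using sets.sets_into_space[OF \<open>A \<in> sets F\<close>] spF by auto
    moreover have "(\<lambda>\<omega>. (\<omega>, Z \<omega>)) -` (A \<times> B) \<inter> space M = A \<inter> (Z -` B \<inter> space M)"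
      using sets.sets_into_space[OF \<open>A \<in> sets F\<close>] spF by auto
    ultimately show "emeasure (distr M F (\<lambda>\<omega>. \<omega>)) A * emeasure (distr M borel Z) B
        = emeasure (distr M (F \<Otimes>\<^sub>M borel) (\<lambda>\<omega>. (\<omega>, Z \<omega>))) (A \<times> B)"
      by (simp add: emeasure_distr emeasure_eq_measure ind ennreal_mult)
  qed (auto intro: F.sigma_finite_measure_axioms Z.sigma_finite_measure_axioms)
  have h': "(\<lambda>y. h \<omega> y) \<in> borel_measurable borel" if "\<omega> \<in> space F" for \<omega>
    using measurable_compose[OF measurable_Pair1'[OF that] h] by simp
  have DZ: "distr M borel Z = density lborel f"
    using distributed_distr_eq_density[OF Z] by (simp cong: distr_cong)
  have "(\<integral>\<^sup>+\<omega>. h \<omega> (Z \<omega>) \<partial>M)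
      = (\<integral>\<^sup>+p. (\<lambda>(\<omega>, y). h \<omega> y) p \<partial>distr M (F \<Otimes>\<^sub>M borel) (\<lambda>\<omega>. (\<omega>, Z \<omega>)))"
    by (subst nn_integral_distr) (use h in \<open>auto\<close>)
  also have "distr M (F \<Otimes>\<^sub>M borel) (\<lambda>\<omega>. (\<omega>, Z \<omega>)) = distr M F (\<lambda>\<omega>. \<omega>) \<Otimes>\<^sub>M distr M borel Z"
    by (rule joint[symmetric])
  also have "(\<integral>\<^sup>+p. (\<lambda>(\<omega>, y). h \<omega> y) p \<partial>(distr M F (\<lambda>\<omega>. \<omega>) \<Otimes>\<^sub>M distr M borel Z))
      = (\<integral>\<^sup>+\<omega>. (\<integral>\<^sup>+y. h \<omega> y \<partial>distr M borel Z) \<partial>distr M F (\<lambda>\<omega>. \<omega>))"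
    using Z.nn_integral_fst[of "\<lambda>(\<omega>, y). h \<omega> y" "distr M F (\<lambda>\<omega>. \<omega>)"] h
    unfolding measurable_cong_sets[OF sets_FZ refl] by simp
  also have "\<dots> = (\<integral>\<^sup>+\<omega>. (\<integral>\<^sup>+y. h \<omega> y \<partial>distr M borel Z) \<partial>M)"
  proof (rule nn_integral_distr)
    show "(\<lambda>\<omega>. \<integral>\<^sup>+y. h \<omega> y \<partial>distr M borel Z) \<in> borel_measurable (distr M F (\<lambda>\<omega>. \<omega>))"
      using Z.borel_measurable_nn_integral_fst[of "\<lambda>(\<omega>, y). h \<omega> y" F] h by simp
  qed simp
  also have "\<dots> = (\<integral>\<^sup>+\<omega>. (\<integral>\<^sup>+y. h \<omega> y * f y \<partial>lborel) \<partial>M)"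
  proof (rule nn_integral_cong)
    fix \<omega> assume "\<omega> \<in> space M"
    hence "\<omega> \<in> space F"
      using measurable_space[of "\<lambda>\<omega>. \<omega>" M F] by auto
    from h'[OF this] show "(\<integral>\<^sup>+y. h \<omega> y \<partial>distr M borel Z) = (\<integral>\<^sup>+y. h \<omega> y * f y \<partial>lborel)"
      unfolding DZ by (subst nn_integral_density) (auto simp: mult.commute)
  qed
  finally show ?thesis .
qed

text \<open>
  The comparison on the \<open>F\<close>-measurable set where the asserted inequality fails shows that this
  set is null; the finite integral of \<open>g\<close> permits subtracting.
\<close>
lemma (in finite_measure_subalgebra) nn_cond_exp_ge:
  assumes f[measurable]: "f \<in> borel_measurable M" and g: "g \<in> borel_measurable F"
    and fin: "(\<integral>\<^sup>+x. g x \<partial>M) < \<infinity>"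
    and le: "\<And>A. A \<in> sets F \<Longrightarrow> (\<integral>\<^sup>+x\<in>A. g x \<partial>M) \<le> (\<integral>\<^sup>+x\<in>A. f x \<partial>M)"
  shows "AE x in M. g x \<le> nn_cond_exp M F f x"
proof -
  let ?n = "nn_cond_exp M F f"
  define A where "A = {x \<in> space F. ?n x < g x}"
  have A: "A \<in> sets F"
    unfolding A_def using g by measurable
  have sp: "space F = space M" and AM[measurable]: "A \<in> sets M"
    using subalg A by (auto simp: subalgebra_def)
  have gM[measurable]: "g \<in> borel_measurable M"
    by (rule measurable_from_subalg[OF subalg g])
  have n_le: "?n x * indicator A x \<le> g x * indicator A x" for x
    by (auto simp: A_def split: split_indicator)
  have "(\<integral>\<^sup>+x\<in>A. g x \<partial>M) \<le> (\<integral>\<^sup>+x. g x \<partial>M)"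
    by (intro nn_integral_mono) (auto split: split_indicator)
  with fin have fin': "(\<integral>\<^sup>+x\<in>A. g x \<partial>M) < \<infinity>"
    by (rule le_less_trans[rotated])
  have "(\<integral>\<^sup>+x\<in>A. ?n x \<partial>M) \<le> (\<integral>\<^sup>+x\<in>A. g x \<partial>M)"
    by (intro nn_integral_mono n_le)
  from le_less_trans[OF this fin'] have fin'': "(\<integral>\<^sup>+x\<in>A. ?n x \<partial>M) \<noteq> \<infinity>"
    by simp
  have "(\<integral>\<^sup>+x\<in>A. g x \<partial>M) \<le> (\<integral>\<^sup>+x\<in>A. ?n x \<partial>M)"
    using le[OF A] nn_cond_exp_intg[of "indicator A" f] A by (simp add: mult.commute)
  moreover have "(\<integral>\<^sup>+x. g x * indicator A x - ?n x * indicator A x \<partial>M)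
      = (\<integral>\<^sup>+x\<in>A. g x \<partial>M) - (\<integral>\<^sup>+x\<in>A. ?n x \<partial>M)"
    by (rule nn_integral_diff) (use fin'' n_le in auto)
  ultimately have "(\<integral>\<^sup>+x. g x * indicator A x - ?n x * indicator A x \<partial>M) = 0"
    using fin' by (simp add: diff_eq_0_ennreal)
  hence "AE x in M. g x * indicator A x - ?n x * indicator A x = 0"
    by (subst (asm) nn_integral_0_iff_AE) auto
  with AE_space show ?thesis
    by eventually_elim (auto simp: A_def sp diff_eq_0_iff_ennreal not_less split: split_indicator_asm intro: leI)
qed

section \<open>The autoregressive market\<close>

text \<open>
  The recursion is required on the sample space only, since a random variable may take arbitrary
  values elsewhere.
\<close>
locale gaussian_ar1 = prob_space M
  for M :: "'a measure" +
  fixes X \<epsilon> :: "nat \<Rightarrow> 'a \<Rightarrow> real" and \<alpha> \<beta> \<sigma> :: real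
  assumes sigma_pos: "\<sigma> > 0"
    and beta_def: "\<beta> = \<alpha> - 1"
    and X0_measurable: "X 0 \<in> borel_measurable M"
    and noise_normal: "t \<ge> 1 \<Longrightarrow> distributed M lborel (\<epsilon> t) (\<lambda>x. ennreal (std_normal_density x))"
    and noise_indep: "indep_vars (\<lambda>_. borel) \<epsilon> {1..}"
    and X0_noise_indep: "indep_set (sets (vimage_algebra (space M) (X 0) borel))
      (sets (vimage_algebra (space M) (\<lambda>\<omega>. \<lambda>t\<in>{1..}. \<epsilon> t \<omega>) (Pi\<^sub>M {1..} (\<lambda>_. borel))))"
    and X_Suc: "\<omega> \<in> space M \<Longrightarrow> X (Suc t) \<omega> = \<alpha> * X t \<omega> + \<sigma> * \<epsilon> (Suc t) \<omega>"
begin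

abbreviation \<F> :: "nat \<Rightarrow> 'a measure" where
  "\<F> \<equiv> natural_filtration M X"

lemma noise_measurable: "t \<ge> 1 \<Longrightarrow> \<epsilon> t \<in> borel_measurable M"
  using distributed_measurable[OF noise_normal] by simp

lemma X_measurable [measurable]: "X t \<in> borel_measurable M"
proof (induction t)
  case (Suc t)
  note [measurable] = Suc.IH noise_measurable[of "Suc t", simplified]
  have "(\<lambda>\<omega>. \<alpha> * X t \<omega> + \<sigma> * \<epsilon> (Suc t) \<omega>) \<in> borel_measurable M"
    by measurable
  thus ?case
    by (subst measurable_cong[OF X_Suc])
qed (rule X0_measurable)

lemma space_filtration [simp]: "space (\<F> t) = space M"
  by (simp add: natural_filtration_def space_measure_of_conv)

lemma sets_filtration:
  "sets (\<F> t) = sigma_sets (space M) (\<Union>s\<in>{0..t}. {X s -` A \<inter> space M | A. A \<in> sets borel})"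
  unfolding natural_filtration_def by (rule sets_measure_of) auto

lemma filtration_least:
  assumes "space N = space M" and "\<And>s. s \<le> t \<Longrightarrow> X s \<in> borel_measurable N"
  shows "sets (\<F> t) \<subseteq> sets N"
  unfolding sets_filtration
proof (rule sets.sigma_sets_subset'[of _ N, unfolded assms(1)])
  show "(\<Union>s\<in>{0..t}. {X s -` A \<inter> space M | A. A \<in> sets borel}) \<subseteq> sets N"
    using measurable_sets[OF assms(2)] by (auto simp: assms(1))
  show "space M \<in> sets N"
    using sets.top[of N] by (simp add: assms(1))
qed

lemma filtration_subalgebra: "subalgebra M (\<F> t)"
  using filtration_least[of M] by (simp add: subalgebra_def)

lemma X_adapted: "s \<le> t \<Longrightarrow> X s \<in> borel_measurable (\<F> t)"
  by (rule measurableI) (force simp: sets_filtration intro!: sigma_sets.Basic)+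

lemma filtration_mono:
  assumes "s \<le> t" and "f \<in> measurable (\<F> s) N"
  shows "f \<in> measurable (\<F> t) N"
proof -
  have "subalgebra (\<F> t) (\<F> s)"
    using filtration_least[of "\<F> t" s] X_adapted assms(1) by (simp add: subalgebra_def)
  thus ?thesis using assms(2) by (rule measurable_from_subalg)
qed

lemma sets_filtration_0: "sets (\<F> 0) = sets (vimage_algebra (space M) (X 0) borel)"
  by (simp add: natural_filtration_def vimage_algebra_def)

text \<open>
  Independence of the starting price from the whole innovation sequence, together with independence
  of the innovations, makes the initial price an additional member of one independent family.
\<close>
lemma indep_start_noise: "indep_vars (\<lambda>_. borel) (\<lambda>t. if t = 0 then X 0 else \<epsilon> t) UNIV"
proof -
  let ?Y = "\<lambda>t. if t = 0 then X 0 else \<epsilon> t"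
  let ?E = "\<lambda>\<omega>. \<lambda>t\<in>{1..}. \<epsilon> t \<omega>"
  let ?V = "vimage_algebra (space M) ?E (Pi\<^sub>M {1..} (\<lambda>_. borel))"
  let ?G = "\<lambda>i. {?Y i -` A \<inter> space M |A. A \<in> sets borel}"
  have Y: "?Y i \<in> borel_measurable M" for i
    using noise_measurable[of i] by simp
  have eps: "indep_sets (\<lambda>i. {\<epsilon> i -` A \<inter> space M |A. A \<in> sets borel}) {1..}"
    using noise_indep by (simp add: indep_vars_def2)
  have E: "?E \<in> measurable ?V (Pi\<^sub>M {1..} (\<lambda>_. borel))"
    by (rule measurable_vimage_algebra1) (auto simp: space_PiM)
  have eV: "\<epsilon> j \<in> borel_measurable ?V" if "j \<ge> 1" for j
    using measurable_compose[OF E measurable_component_singleton[of j]] that by simp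
  have "indep_sets ?G UNIV"
  proof (rule indep_setsI)
    show "?G i \<subseteq> events" for i
      using measurable_sets[OF Y[of i]] by blast
  next
    fix A J assume J: "J \<noteq> {}" "finite J" and A: "\<forall>j\<in>J. A j \<in> ?G j"
    have A_eps: "A j \<in> {\<epsilon> j -` B \<inter> space M |B. B \<in> sets borel}" if "j \<in> J - {0}" for j
      using bspec[OF A, of j] that by simp
    have noise: "prob (\<Inter>j\<in>K. A j) = (\<Prod>j\<in>K. prob (A j))"
      if K: "K \<subseteq> J - {0}" "K \<noteq> {}" for K
    proof (rule indep_setsD[OF eps _ K(2)])
      show "finite K" using K J finite_subset by blast
      show "K \<subseteq> {1..}" using K by (auto simp: Suc_le_eq)
      show "\<forall>j\<in>K. A j \<in> {\<epsilon> j -` B \<inter> space M |B. B \<in> sets borel}"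
        using A_eps K by blast
    qed
    show "prob (\<Inter>j\<in>J. A j) = (\<Prod>j\<in>J. prob (A j))"
    proof (cases "0 \<in> J \<and> J - {0} \<noteq> {}")
      case False
      hence "J = {0} \<or> 0 \<notin> J" by auto
      thus ?thesis
        using noise[of J] J by auto
    next
      case True
      let ?B = "\<Inter>j\<in>J - {0}. A j"
      have "A j \<in> sets ?V" if "j \<in> J - {0}" for j
      proof -
        from A_eps[OF that] obtain S where S: "S \<in> sets borel" "A j = \<epsilon> j -` S \<inter> space M"
          by blast
        thus ?thesis
          using measurable_sets[OF eV[of j] S(1)] that by simp
      qed
      hence "?B \<in> sets ?V"
        using True J by (intro sets.finite_INT) auto
      moreover have "A 0 \<in> sets (vimage_algebra (space M) (X 0) borel)"
        using A True by (auto simp: sets_vimage_algebra2)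
      ultimately have "prob (A 0 \<inter> ?B) = prob (A 0) * prob ?B"
        by (intro indep_setD[OF X0_noise_indep])
      moreover have "(\<Inter>j\<in>J. A j) = A 0 \<inter> ?B"
        using True by auto
      ultimately show ?thesis
        using noise[of "J - {0}"] True J by (simp add: prod.remove[of J 0])
    qed
  qed
  thus ?thesis
    using Y by (simp add: indep_vars_def2)
qed

text \<open>
  Prices up to time \<open>t\<close> are functions of the starting price and the first \<open>t\<close> innovations, a block of the
  independent family that is disjoint from the innovation at time \<open>t + 1\<close>.
\<close>
lemma indep_past_next_noise:
  assumes A: "A \<in> sets (\<F> t)" and B: "B \<in> sets borel"
  shows "prob (A \<inter> (\<epsilon> (Suc t) -` B \<inter> space M)) = prob A * prob (\<epsilon> (Suc t) -` B \<inter> space M)"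
proof -
  let ?Y = "\<lambda>t. if t = 0 then X 0 else \<epsilon> t"
  let ?P = "\<lambda>\<omega>. \<lambda>i\<in>{..t}. ?Y i \<omega>" and ?Q = "\<lambda>\<omega>. \<lambda>i\<in>{Suc t}. ?Y i \<omega>"
  define V where "V = vimage_algebra (space M) ?P (Pi\<^sub>M {..t} (\<lambda>_. borel))"
  have space_V: "space V = space M" by (simp add: V_def)
  have ind: "indep_var (Pi\<^sub>M {..t} (\<lambda>_. borel)) ?P (Pi\<^sub>M {Suc t} (\<lambda>_. borel)) ?Q"
    by (rule indep_var_restrict[OF indep_start_noise]) auto
  have P: "?P \<in> measurable V (Pi\<^sub>M {..t} (\<lambda>_. borel))"
    unfolding V_def by (rule measurable_vimage_algebra1) (auto simp: space_PiM)
  have Y: "?Y i \<in> borel_measurable V" if "i \<le> t" for i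
    using measurable_compose[OF P measurable_component_singleton[of i]] that by simp
  have "X s \<in> borel_measurable V" if "s \<le> t" for s
    using that
  proof (induction s)
    case 0
    show ?case using Y[of 0] by (simp only: if_True simp_thms le0)
  next
    case (Suc s)
    have "(\<lambda>\<omega>. \<alpha> * X s \<omega> + \<sigma> * \<epsilon> (Suc s) \<omega>) \<in> borel_measurable V"
      using Suc.IH Suc.prems Y[of "Suc s"] by simp
    thus ?case
      by (subst measurable_cong[OF X_Suc]) (auto simp: space_V)
  qed
  hence "sets (\<F> t) \<subseteq> sets V"
    by (intro filtration_least space_V)
  with A have "A \<in> sets V" by auto
  then obtain S where S: "S \<in> sets (Pi\<^sub>M {..t} (\<lambda>_. borel))" "A = ?P -` S \<inter> space M"
    unfolding V_def by (subst (asm) sets_vimage_algebra2) (auto simp: space_PiM)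
  define S' where "S' = {f \<in> space (Pi\<^sub>M {Suc t} (\<lambda>_. borel)). f (Suc t) \<in> B}"
  have "S' \<in> sets (Pi\<^sub>M {Suc t} (\<lambda>_. borel))"
    unfolding S'_def using B by measurable
  moreover have "?Q -` S' \<inter> space M = \<epsilon> (Suc t) -` B \<inter> space M"
    by (auto simp: S'_def space_PiM)
  moreover have "(\<lambda>\<omega>. (?P \<omega>, ?Q \<omega>)) -` (S \<times> S') \<inter> space M = A \<inter> (?Q -` S' \<inter> space M)"
    using S(2) by auto
  ultimately show ?thesis
    using indep_varD[OF ind S(1), of S'] S(2) by simp
qed

text \<open>
  The moment formula behind every backward step: given the past, \<open>X (t+1)\<close> is normal with mean
  \<open>\<alpha> X t\<close> and variance \<open>\<sigma>^2\<close>, and the exponent is quadratic in it with coefficients known at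
  time \<open>t\<close>.
\<close>
lemma nn_integral_exp_next:
  assumes G: "G \<in> borel_measurable (\<F> t)"
    and p: "p \<in> borel_measurable (\<F> t)" and q: "q \<in> borel_measurable (\<F> t)" and a: "a \<ge> 0"
  shows "(\<integral>\<^sup>+\<omega>. G \<omega> * ennreal (exp (- (p \<omega> * X (Suc t) \<omega> + a * (X (Suc t) \<omega>)\<^sup>2 + q \<omega>))) \<partial>M)
    = (\<integral>\<^sup>+\<omega>. G \<omega> * ennreal (exp (\<sigma>\<^sup>2 * (p \<omega> + 2 * a * \<alpha> * X t \<omega>)\<^sup>2 / (2 * (1 + 2 * a * \<sigma>\<^sup>2))
        - (p \<omega> * \<alpha> * X t \<omega> + a * (\<alpha> * X t \<omega>)\<^sup>2 + q \<omega>)) / sqrt (1 + 2 * a * \<sigma>\<^sup>2)) \<partial>M)"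
proof -
  note [measurable] = G p q X_adapted[of t t, simplified]
  define h where "h = (\<lambda>\<omega> y. G \<omega> * ennreal (exp (- (p \<omega> * (\<alpha> * X t \<omega> + \<sigma> * y) +
    a * (\<alpha> * X t \<omega> + \<sigma> * y)\<^sup>2 + q \<omega>))))"
  have h: "(\<lambda>(\<omega>, y). h \<omega> y) \<in> borel_measurable (\<F> t \<Otimes>\<^sub>M borel)"
    unfolding h_def by measurable
  have "(\<integral>\<^sup>+\<omega>. G \<omega> * ennreal (exp (- (p \<omega> * X (Suc t) \<omega> + a * (X (Suc t) \<omega>)\<^sup>2 + q \<omega>))) \<partial>M)
      = (\<integral>\<^sup>+\<omega>. h \<omega> (\<epsilon> (Suc t) \<omega>) \<partial>M)"
    by (intro nn_integral_cong) (simp add: h_def X_Suc)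
  also have "\<dots> = (\<integral>\<^sup>+\<omega>. (\<integral>\<^sup>+y. h \<omega> y * ennreal (std_normal_density y) \<partial>lborel) \<partial>M)"
    by (rule nn_integral_freeze_independent[OF filtration_subalgebra indep_past_next_noise
          noise_normal h]) auto
  also have "\<dots> = (\<integral>\<^sup>+\<omega>. G \<omega> * ennreal (exp (\<sigma>\<^sup>2 * (p \<omega> + 2 * a * \<alpha> * X t \<omega>)\<^sup>2 / (2 * (1 + 2 * a * \<sigma>\<^sup>2))
        - (p \<omega> * \<alpha> * X t \<omega> + a * (\<alpha> * X t \<omega>)\<^sup>2 + q \<omega>)) / sqrt (1 + 2 * a * \<sigma>\<^sup>2)) \<partial>M)"
  proof (rule nn_integral_cong)
    fix \<omega>
    have expand: "p \<omega> * (\<alpha> * X t \<omega> + \<sigma> * y) + a * (\<alpha> * X t \<omega> + \<sigma> * y)\<^sup>2 + q \<omega>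
      = (a * \<sigma>\<^sup>2) * y\<^sup>2 + (\<sigma> * (p \<omega> + 2 * a * \<alpha> * X t \<omega>)) * y
        + (p \<omega> * \<alpha> * X t \<omega> + a * (\<alpha> * X t \<omega>)\<^sup>2 + q \<omega>)" for y
      by (simp add: power2_eq_square algebra_simps)
    have "(\<integral>\<^sup>+y. h \<omega> y * ennreal (std_normal_density y) \<partial>lborel)
      = G \<omega> * (\<integral>\<^sup>+y. ennreal (exp (- ((a * \<sigma>\<^sup>2) * y\<^sup>2 + (\<sigma> * (p \<omega> + 2 * a * \<alpha> * X t \<omega>)) * y
        + (p \<omega> * \<alpha> * X t \<omega> + a * (\<alpha> * X t \<omega>)\<^sup>2 + q \<omega>)))) * ennreal (std_normal_density y) \<partial>lborel)"
      unfolding h_def expand mult.assoc[of "G \<omega>"] by (rule nn_integral_cmult) simp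
    also have "\<dots> = G \<omega> * ennreal (exp (\<sigma>\<^sup>2 * (p \<omega> + 2 * a * \<alpha> * X t \<omega>)\<^sup>2 / (2 * (1 + 2 * a * \<sigma>\<^sup>2))
        - (p \<omega> * \<alpha> * X t \<omega> + a * (\<alpha> * X t \<omega>)\<^sup>2 + q \<omega>)) / sqrt (1 + 2 * a * \<sigma>\<^sup>2))"
      using a by (subst nn_integral_std_normal_exp_quadratic) (simp_all add: power_mult_distrib mult.assoc)
    finally show "(\<integral>\<^sup>+y. h \<omega> y * ennreal (std_normal_density y) \<partial>lborel) = \<dots>" .
  qed
  finally show ?thesis .
qed

end

section \<open>Trading on past information\<close>

context gaussian_ar1
begin

lemma wealth_0 [simp]: "wealth X 0 \<phi> \<omega> = 0"
  by (simp add: wealth_def)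

lemma wealth_Suc [simp]:
  "wealth X (Suc t) \<phi> \<omega> = wealth X t \<phi> \<omega> + \<phi> (Suc t) \<omega> * (X (Suc t) \<omega> - X t \<omega>)"
  by (simp add: wealth_def)

lemma phi_hat_measurable: "phi_hat \<beta> \<sigma> T t \<in> borel_measurable borel"
  unfolding phi_hat_def[abs_def] by measurable

lemma phi_star_strategy: "phi_star \<beta> \<sigma> X T \<in> strategies M X"
proof -
  have "phi_star \<beta> \<sigma> X T t \<in> borel_measurable (\<F> (t - 1))" for t
    unfolding phi_star_def[abs_def] by (rule measurable_compose[OF X_adapted phi_hat_measurable]) simp
  thus ?thesis by (simp add: strategies_def)
qed

lemma eta_star_strategy: "eta_star \<beta> \<sigma> X T \<in> strategies0 M X T"
proof -
  have "eta_star \<beta> \<sigma> X T t \<in> borel_measurable (\<F> s)" for s t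
    unfolding eta_star_def[abs_def] by (rule measurable_compose[OF X_adapted phi_hat_measurable]) simp
  thus ?thesis by (simp add: strategies0_def strategies_def)
qed

lemma strategy_measurable:
  "\<phi> \<in> strategies M X \<Longrightarrow> \<phi> (Suc t) \<in> borel_measurable (\<F> t)"
  unfolding strategies_def using diff_Suc_1[of t] by (auto dest!: spec[of _ "Suc t"])

lemma wealth_adapted:
  assumes "\<phi> \<in> strategies M X"
  shows "wealth X t \<phi> \<in> borel_measurable (\<F> t)"
proof (induction t)
  case (Suc t)
  note [measurable] = filtration_mono[OF _ Suc.IH, of "Suc t", simplified]
    filtration_mono[OF _ strategy_measurable[OF assms], of t "Suc t", simplified]
    X_adapted[of t "Suc t", simplified] X_adapted[of "Suc t" "Suc t", simplified]
  show ?case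
    unfolding wealth_Suc[abs_def] by measurable
qed (simp add: wealth_0[abs_def])

lemma wealth_measurable:
  assumes "\<phi> \<in> strategies M X"
  shows "wealth X t \<phi> \<in> borel_measurable M"
  by (rule measurable_from_subalg[OF filtration_subalgebra wealth_adapted[OF assms]])

text \<open>
  The least expected disutility over \<open>k\<close> periods of trading on past prices, for a price process
  starting at zero.
\<close>
definition risk_factor :: "nat \<Rightarrow> real" where
  "risk_factor k = (\<Prod>i<k. 1 / sqrt (1 + real i * \<beta>\<^sup>2))"

lemma risk_factor_nonneg: "risk_factor k \<ge> 0"
  unfolding risk_factor_def by (intro prod_nonneg) simp

text \<open>
  The Bellman equation of the problem with past information: the exponent obtained by integrating
  out one period is that of the value function with one more period to go plus a square,
  and the square vanishes at the position \<open>p = \<beta> x (1 - k \<beta>) / \<sigma>^2\<close>.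
\<close>
lemma quadratic_gap:
  fixes k p x q :: real
  assumes k: "k \<ge> 0" and D: "D = 1 + k * \<beta>\<^sup>2" and a: "a = \<beta>\<^sup>2 * k / (2 * \<sigma>\<^sup>2)"
  shows "\<sigma>\<^sup>2 * (p + 2 * a * \<alpha> * x)\<^sup>2 / (2 * D) - (p * \<alpha> * x + a * (\<alpha> * x)\<^sup>2 + (q - p * x))
    = (\<sigma>\<^sup>2 * p - \<beta> * x * (1 - k * \<beta>))\<^sup>2 / (2 * D * \<sigma>\<^sup>2) - (q + \<beta>\<^sup>2 * (k + 1) / (2 * \<sigma>\<^sup>2) * x\<^sup>2)"
proof -
  have "D > 0" using k by (simp add: D add_pos_nonneg)
  define s where "s = \<sigma>\<^sup>2"
  have "s > 0" using sigma_pos by (simp add: s_def)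
  have \<alpha>: "\<alpha> = \<beta> + 1" using beta_def by simp
  have "s * (p + 2 * a * \<alpha> * x)\<^sup>2 / (2 * D) = (s * p + \<beta>\<^sup>2 * k * \<alpha> * x)\<^sup>2 / (2 * D * s)"
    using \<open>s > 0\<close> \<open>D > 0\<close> by (simp add: a s_def[symmetric] divide_simps) (simp add: power2_eq_square algebra_simps)
  moreover have "(s * p + \<beta>\<^sup>2 * k * \<alpha> * x)\<^sup>2 - 2 * D * s * (p * \<alpha> * x - p * x) - D * \<beta>\<^sup>2 * k * (\<alpha> * x)\<^sup>2
      = (s * p - \<beta> * x * (1 - k * \<beta>))\<^sup>2 - D * \<beta>\<^sup>2 * (k + 1) * x\<^sup>2"
    unfolding D \<alpha> by (simp add: power2_eq_square algebra_simps)
  moreover have "D * \<beta>\<^sup>2 * (k + 1) * x\<^sup>2 / (2 * D * s) = \<beta>\<^sup>2 * (k + 1) / (2 * s) * x\<^sup>2"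
    "D * \<beta>\<^sup>2 * k * (\<alpha> * x)\<^sup>2 / (2 * D * s) = a * (\<alpha> * x)\<^sup>2"
    "2 * D * s * (p * \<alpha> * x - p * x) / (2 * D * s) = p * \<alpha> * x - p * x"
    using \<open>s > 0\<close> \<open>D > 0\<close> by (simp_all add: a s_def[symmetric] mult.assoc)
  ultimately have "s * (p + 2 * a * \<alpha> * x)\<^sup>2 / (2 * D) - (p * \<alpha> * x - p * x) - a * (\<alpha> * x)\<^sup>2
    = (s * p - \<beta> * x * (1 - k * \<beta>))\<^sup>2 / (2 * D * s) - \<beta>\<^sup>2 * (k + 1) / (2 * s) * x\<^sup>2"
    by (metis diff_divide_distrib)
  thus ?thesis
    unfolding s_def[symmetric] by linarith
qed

lemma le_mult_exp: "x \<ge> 0 \<Longrightarrow> g \<ge> 0 \<Longrightarrow> x \<le> x * exp g" for x g :: real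
  by (simp add: mult_le_cancel_left1)

text \<open>
  One backward step for a strategy using past prices. The last exponential measures the loss
  against the optimal position at time \<open>t + 1\<close>, when \<open>k\<close> further periods remain.
\<close>
lemma past_info_step:
  assumes \<phi>: "\<phi> \<in> strategies M X" and G: "G \<in> borel_measurable (\<F> 0)" and t: "t < T"
  defines "k \<equiv> T - Suc t"
  shows "(\<integral>\<^sup>+\<omega>. G \<omega> * ennreal (risk_factor k *
        exp (- (wealth X (Suc t) \<phi> \<omega> + \<beta>\<^sup>2 * real k / (2 * \<sigma>\<^sup>2) * (X (Suc t) \<omega>)\<^sup>2))) \<partial>M)
    = (\<integral>\<^sup>+\<omega>. G \<omega> * ennreal (risk_factor (T - t) *
        exp (- (wealth X t \<phi> \<omega> + \<beta>\<^sup>2 * real (T - t) / (2 * \<sigma>\<^sup>2) * (X t \<omega>)\<^sup>2)) *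
        exp ((\<sigma>\<^sup>2 * \<phi> (Suc t) \<omega> - \<beta> * X t \<omega> * (1 - real k * \<beta>))\<^sup>2 / (2 * (1 + real k * \<beta>\<^sup>2) * \<sigma>\<^sup>2))) \<partial>M)"
proof -
  define a where "a = \<beta>\<^sup>2 * real k / (2 * \<sigma>\<^sup>2)"
  define D where "D = 1 + real k * \<beta>\<^sup>2"
  have Tk: "T - t = Suc k" using t by (simp add: k_def)
  have aD: "1 + 2 * a * \<sigma>\<^sup>2 = D" and a0: "a \<ge> 0"
    using sigma_pos by (simp_all add: a_def D_def)
  note [measurable] = filtration_mono[OF le0 G, of t] strategy_measurable[OF \<phi>, of t]
    wealth_adapted[OF \<phi>, of t] X_adapted[of t t, simplified]
  have "(\<integral>\<^sup>+\<omega>. G \<omega> * ennreal (risk_factor k *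
        exp (- (wealth X (Suc t) \<phi> \<omega> + a * (X (Suc t) \<omega>)\<^sup>2))) \<partial>M)
      = (\<integral>\<^sup>+\<omega>. (G \<omega> * ennreal (risk_factor k)) * ennreal (exp (- (\<phi> (Suc t) \<omega> * X (Suc t) \<omega> +
          a * (X (Suc t) \<omega>)\<^sup>2 + (wealth X t \<phi> \<omega> - \<phi> (Suc t) \<omega> * X t \<omega>)))) \<partial>M)"
    by (intro nn_integral_cong)
       (simp add: ennreal_mult risk_factor_nonneg mult.assoc algebra_simps)
  also have "\<dots> = (\<integral>\<^sup>+\<omega>. (G \<omega> * ennreal (risk_factor k)) *
      ennreal (exp (\<sigma>\<^sup>2 * (\<phi> (Suc t) \<omega> + 2 * a * \<alpha> * X t \<omega>)\<^sup>2 / (2 * D)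
        - (\<phi> (Suc t) \<omega> * \<alpha> * X t \<omega> + a * (\<alpha> * X t \<omega>)\<^sup>2 +
           (wealth X t \<phi> \<omega> - \<phi> (Suc t) \<omega> * X t \<omega>))) / sqrt D) \<partial>M)"
    unfolding aD[symmetric] by (rule nn_integral_exp_next) (use a0 in measurable)
  also have "\<dots> = (\<integral>\<^sup>+\<omega>. G \<omega> * ennreal (risk_factor (T - t) *
        exp (- (wealth X t \<phi> \<omega> + \<beta>\<^sup>2 * real (T - t) / (2 * \<sigma>\<^sup>2) * (X t \<omega>)\<^sup>2)) *
        exp ((\<sigma>\<^sup>2 * \<phi> (Suc t) \<omega> - \<beta> * X t \<omega> * (1 - real k * \<beta>))\<^sup>2 / (2 * D * \<sigma>\<^sup>2))) \<partial>M)"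
  proof (rule nn_integral_cong)
    fix \<omega>
    have "risk_factor (T - t) = risk_factor k / sqrt D"
      by (simp add: Tk risk_factor_def D_def)
    moreover have "exp (\<sigma>\<^sup>2 * (\<phi> (Suc t) \<omega> + 2 * a * \<alpha> * X t \<omega>)\<^sup>2 / (2 * D)
        - (\<phi> (Suc t) \<omega> * \<alpha> * X t \<omega> + a * (\<alpha> * X t \<omega>)\<^sup>2 + (wealth X t \<phi> \<omega> - \<phi> (Suc t) \<omega> * X t \<omega>)))
      = exp (- (wealth X t \<phi> \<omega> + \<beta>\<^sup>2 * real (T - t) / (2 * \<sigma>\<^sup>2) * (X t \<omega>)\<^sup>2)) *
        exp ((\<sigma>\<^sup>2 * \<phi> (Suc t) \<omega> - \<beta> * X t \<omega> * (1 - real k * \<beta>))\<^sup>2 / (2 * D * \<sigma>\<^sup>2))"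
      by (subst quadratic_gap[OF _ D_def a_def]) (simp_all add: Tk add.commute flip: exp_add)
    ultimately show "(G \<omega> * ennreal (risk_factor k)) *
      ennreal (exp (\<sigma>\<^sup>2 * (\<phi> (Suc t) \<omega> + 2 * a * \<alpha> * X t \<omega>)\<^sup>2 / (2 * D)
        - (\<phi> (Suc t) \<omega> * \<alpha> * X t \<omega> + a * (\<alpha> * X t \<omega>)\<^sup>2 +
           (wealth X t \<phi> \<omega> - \<phi> (Suc t) \<omega> * X t \<omega>))) / sqrt D) =
      G \<omega> * ennreal (risk_factor (T - t) *
        exp (- (wealth X t \<phi> \<omega> + \<beta>\<^sup>2 * real (T - t) / (2 * \<sigma>\<^sup>2) * (X t \<omega>)\<^sup>2)) *
        exp ((\<sigma>\<^sup>2 * \<phi> (Suc t) \<omega> - \<beta> * X t \<omega> * (1 - real k * \<beta>))\<^sup>2 / (2 * D * \<sigma>\<^sup>2)))"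
      by (simp add: mult.assoc risk_factor_nonneg D_def flip: ennreal_mult)
  qed
  finally show ?thesis by (simp add: a_def D_def)
qed

text \<open>
  Every loss factor is at least one, so iterating the step gives a lower bound that is free of the
  strategy. The weight \<open>G\<close> ranges over functions of the initial price, which is what conditioning on
  \<open>X 0\<close> requires.
\<close>
lemma past_info_bound:
  assumes \<phi>: "\<phi> \<in> strategies M X" and G: "G \<in> borel_measurable (\<F> 0)"
  shows "(\<integral>\<^sup>+\<omega>. G \<omega> * ennreal (risk_factor T * exp (- (\<beta>\<^sup>2 * (X 0 \<omega>)\<^sup>2 / (2 * \<sigma>\<^sup>2) * real T))) \<partial>M)
    \<le> (\<integral>\<^sup>+\<omega>. G \<omega> * ennreal (exp (- wealth X T \<phi> \<omega>)) \<partial>M)"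
proof -
  define I where "I = (\<lambda>t. \<integral>\<^sup>+\<omega>. G \<omega> * ennreal (risk_factor (T - t) *
    exp (- (wealth X t \<phi> \<omega> + \<beta>\<^sup>2 * real (T - t) / (2 * \<sigma>\<^sup>2) * (X t \<omega>)\<^sup>2))) \<partial>M)"
  have "I 0 \<le> I t" if "t \<le> T" for t
    using that
  proof (induction t)
    case (Suc t)
    have "I t \<le> I (Suc t)"
      unfolding I_def using Suc.prems
      by (subst past_info_step[OF \<phi> G])
         (auto intro!: nn_integral_mono mult_left_mono ennreal_leI le_mult_exp mult_nonneg_nonneg divide_nonneg_nonneg risk_factor_nonneg)
    with Suc show ?case by simp
  qed simp
  from this[of T] show ?thesis
    by (simp add: I_def risk_factor_def[of 0] algebra_simps)
qed

text \<open>
  The positions \<open>phi_star\<close> make each loss factor equal to one.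
\<close>
lemma past_info_attained:
  assumes G: "G \<in> borel_measurable (\<F> 0)"
  shows "(\<integral>\<^sup>+\<omega>. G \<omega> * ennreal (risk_factor T * exp (- (\<beta>\<^sup>2 * (X 0 \<omega>)\<^sup>2 / (2 * \<sigma>\<^sup>2) * real T))) \<partial>M)
    = (\<integral>\<^sup>+\<omega>. G \<omega> * ennreal (exp (- wealth X T (phi_star \<beta> \<sigma> X T) \<omega>)) \<partial>M)"
proof -
  define \<phi> where "\<phi> = phi_star \<beta> \<sigma> X T"
  define I where "I = (\<lambda>t. \<integral>\<^sup>+\<omega>. G \<omega> * ennreal (risk_factor (T - t) *
    exp (- (wealth X t \<phi> \<omega> + \<beta>\<^sup>2 * real (T - t) / (2 * \<sigma>\<^sup>2) * (X t \<omega>)\<^sup>2))) \<partial>M)"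
  have "I 0 = I t" if "t \<le> T" for t
    using that
  proof (induction t)
    case (Suc t)
    have "\<sigma>\<^sup>2 * \<phi> (Suc t) \<omega> = \<beta> * X t \<omega> * (1 - real (T - Suc t) * \<beta>)" for \<omega>
      using sigma_pos Suc.prems
      by (simp add: \<phi>_def phi_star_def phi_hat_def theta_def of_nat_diff)
    hence "I t = I (Suc t)"
      unfolding I_def using Suc.prems
      by (subst past_info_step[OF phi_star_strategy[of T, folded \<phi>_def] G]) auto
    with Suc show ?case by simp
  qed simp
  from this[of T] show ?thesis
    by (simp add: I_def risk_factor_def[of 0] algebra_simps \<phi>_def)
qed

section \<open>Trading on initial information\<close>

text \<open>
  Since \<open>X j\<close> has conditional mean \<open>\<alpha> ^ (j - t) * X t\<close> given the past up to \<open>t\<close>, the gains after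
  \<open>t\<close> from positions fixed at the start have conditional mean \<open>\<beta> * discounted_tail T \<phi> t * X t\<close>.
\<close>
definition discounted_tail :: "nat \<Rightarrow> (nat \<Rightarrow> 'a \<Rightarrow> real) \<Rightarrow> nat \<Rightarrow> 'a \<Rightarrow> real" where
  "discounted_tail T \<phi> t \<omega> = (\<Sum>j=Suc t..T. \<alpha> ^ (j - Suc t) * \<phi> j \<omega>)"

lemma discounted_tail_rec:
  assumes "t < T"
  shows "discounted_tail T \<phi> t \<omega> = \<phi> (Suc t) \<omega> + \<alpha> * discounted_tail T \<phi> (Suc t) \<omega>"
proof -
  have "discounted_tail T \<phi> t \<omega> = \<phi> (Suc t) \<omega> + (\<Sum>j=Suc (Suc t)..T. \<alpha> ^ (j - Suc t) * \<phi> j \<omega>)"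
    using assms unfolding discounted_tail_def by (subst sum.atLeast_Suc_atMost) simp_all
  also have "(\<Sum>j=Suc (Suc t)..T. \<alpha> ^ (j - Suc t) * \<phi> j \<omega>) = \<alpha> * discounted_tail T \<phi> (Suc t) \<omega>"
    unfolding discounted_tail_def sum_distrib_left
  proof (intro sum.cong refl)
    fix j assume "j \<in> {Suc (Suc t)..T}"
    hence "j - Suc t = Suc (j - Suc (Suc t))" by auto
    thus "\<alpha> ^ (j - Suc t) * \<phi> j \<omega> = \<alpha> * (\<alpha> ^ (j - Suc (Suc t)) * \<phi> j \<omega>)"
      by simp
  qed
  finally show ?thesis .
qed

lemma strategies0_D:
  assumes "\<phi> \<in> strategies0 M X T"
  shows "\<phi> \<in> strategies M X" and "1 \<le> j \<Longrightarrow> j \<le> T \<Longrightarrow> \<phi> j \<in> borel_measurable (\<F> 0)"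
  using assms by (auto simp: strategies0_def)

text \<open>
  One backward step for positions known at the start. Measuring the price from \<open>X 0\<close> in the tail
  term lets the remaining exponent split into one square per period, with
  \<open>\<phi> (t+1) + \<beta> R (t+1)\<close> as the total exposure of the terminal wealth to the innovation at \<open>t + 1\<close>.
\<close>
lemma initial_info_step:
  assumes \<phi>: "\<phi> \<in> strategies0 M X T" and G: "G \<in> borel_measurable (\<F> 0)" and t: "t < T"
  defines "R \<equiv> discounted_tail T \<phi>"
  shows "(\<integral>\<^sup>+\<omega>. G \<omega> * ennreal (exp (- (wealth X (Suc t) \<phi> \<omega> + \<beta> * R (Suc t) \<omega> * (X (Suc t) \<omega> - X 0 \<omega>)
        + \<beta>\<^sup>2 * real (T - Suc t) / (2 * \<sigma>\<^sup>2) * (X 0 \<omega>)\<^sup>2))) \<partial>M)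
    = (\<integral>\<^sup>+\<omega>. G \<omega> * ennreal (exp (- (wealth X t \<phi> \<omega> + \<beta> * R t \<omega> * (X t \<omega> - X 0 \<omega>)
        + \<beta>\<^sup>2 * real (T - t) / (2 * \<sigma>\<^sup>2) * (X 0 \<omega>)\<^sup>2)) *
        exp ((\<sigma>\<^sup>2 * (\<phi> (Suc t) \<omega> + \<beta> * R (Suc t) \<omega>) - \<beta> * X 0 \<omega>)\<^sup>2 / (2 * \<sigma>\<^sup>2))) \<partial>M)"
proof -
  define k where "k = T - Suc t"
  have Tk: "T - t = Suc k" using t by (simp add: k_def)
  note \<phi>' = strategies0_D(1)[OF \<phi>]
  have R0: "R s \<in> borel_measurable (\<F> 0)" for s
    unfolding R_def discounted_tail_def
    by (intro borel_measurable_sum borel_measurable_times borel_measurable_const strategies0_D(2)[OF \<phi>]) auto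
  note [measurable] = filtration_mono[OF le0 G, of t] strategy_measurable[OF \<phi>', of t]
    wealth_adapted[OF \<phi>', of t] X_adapted[of t t, simplified] X_adapted[of 0 t, simplified]
    filtration_mono[OF le0 R0, where t = t]
  let ?w = "\<lambda>\<omega>. \<phi> (Suc t) \<omega> + \<beta> * R (Suc t) \<omega>"
  let ?q = "\<lambda>\<omega>. wealth X t \<phi> \<omega> - \<phi> (Suc t) \<omega> * X t \<omega> - \<beta> * R (Suc t) \<omega> * X 0 \<omega>
    + \<beta>\<^sup>2 * real k / (2 * \<sigma>\<^sup>2) * (X 0 \<omega>)\<^sup>2"
  have "(\<integral>\<^sup>+\<omega>. G \<omega> * ennreal (exp (- (wealth X (Suc t) \<phi> \<omega> + \<beta> * R (Suc t) \<omega> * (X (Suc t) \<omega> - X 0 \<omega>)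
        + \<beta>\<^sup>2 * real k / (2 * \<sigma>\<^sup>2) * (X 0 \<omega>)\<^sup>2))) \<partial>M)
      = (\<integral>\<^sup>+\<omega>. G \<omega> * ennreal (exp (- (?w \<omega> * X (Suc t) \<omega> + 0 * (X (Suc t) \<omega>)\<^sup>2 + ?q \<omega>))) \<partial>M)"
    by (intro nn_integral_cong arg_cong2[where f="(*)"] arg_cong[where f=ennreal] arg_cong[where f=exp] refl)
       (simp add: algebra_simps)
  also have "\<dots> = (\<integral>\<^sup>+\<omega>. G \<omega> * ennreal (exp (\<sigma>\<^sup>2 * (?w \<omega> + 2 * 0 * \<alpha> * X t \<omega>)\<^sup>2 / (2 * (1 + 2 * 0 * \<sigma>\<^sup>2))
        - (?w \<omega> * \<alpha> * X t \<omega> + 0 * (\<alpha> * X t \<omega>)\<^sup>2 + ?q \<omega>)) / sqrt (1 + 2 * 0 * \<sigma>\<^sup>2)) \<partial>M)"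
    by (rule nn_integral_exp_next[OF _ _ _ order_refl]) measurable
  also have "\<dots> = (\<integral>\<^sup>+\<omega>. G \<omega> * ennreal (exp (- (wealth X t \<phi> \<omega> + \<beta> * R t \<omega> * (X t \<omega> - X 0 \<omega>)
        + \<beta>\<^sup>2 * real (T - t) / (2 * \<sigma>\<^sup>2) * (X 0 \<omega>)\<^sup>2)) *
        exp ((\<sigma>\<^sup>2 * ?w \<omega> - \<beta> * X 0 \<omega>)\<^sup>2 / (2 * \<sigma>\<^sup>2))) \<partial>M)"
  proof (rule nn_integral_cong)
    fix \<omega>
    have R: "R t \<omega> = \<phi> (Suc t) \<omega> + \<alpha> * R (Suc t) \<omega>"
      unfolding R_def by (rule discounted_tail_rec[OF t])
    have \<alpha>: "\<alpha> = \<beta> + 1" using beta_def by simp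
    have sq: "(\<sigma>\<^sup>2 * ?w \<omega> - \<beta> * X 0 \<omega>)\<^sup>2 / (2 * \<sigma>\<^sup>2)
        = \<sigma>\<^sup>2 * (?w \<omega>)\<^sup>2 / 2 - ?w \<omega> * \<beta> * X 0 \<omega> + \<beta>\<^sup>2 * (X 0 \<omega>)\<^sup>2 / (2 * \<sigma>\<^sup>2)"
      using sigma_pos by (simp add: field_simps power2_eq_square)
    have real_Tk: "\<beta>\<^sup>2 * real (T - t) / (2 * \<sigma>\<^sup>2) * (X 0 \<omega>)\<^sup>2
        = \<beta>\<^sup>2 * real k / (2 * \<sigma>\<^sup>2) * (X 0 \<omega>)\<^sup>2 + \<beta>\<^sup>2 * (X 0 \<omega>)\<^sup>2 / (2 * \<sigma>\<^sup>2)"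
      by (simp add: Tk add_divide_distrib algebra_simps)
    have "\<sigma>\<^sup>2 * (?w \<omega>)\<^sup>2 / 2 - (?w \<omega> * \<alpha> * X t \<omega> + ?q \<omega>)
        = - (wealth X t \<phi> \<omega> + \<beta> * R t \<omega> * (X t \<omega> - X 0 \<omega>)
          + \<beta>\<^sup>2 * real (T - t) / (2 * \<sigma>\<^sup>2) * (X 0 \<omega>)\<^sup>2)
          + (\<sigma>\<^sup>2 * ?w \<omega> - \<beta> * X 0 \<omega>)\<^sup>2 / (2 * \<sigma>\<^sup>2)"
      unfolding sq real_Tk R \<alpha> by (simp add: algebra_simps)
    thus "G \<omega> * ennreal (exp (\<sigma>\<^sup>2 * (?w \<omega> + 2 * 0 * \<alpha> * X t \<omega>)\<^sup>2 / (2 * (1 + 2 * 0 * \<sigma>\<^sup>2))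
        - (?w \<omega> * \<alpha> * X t \<omega> + 0 * (\<alpha> * X t \<omega>)\<^sup>2 + ?q \<omega>)) / sqrt (1 + 2 * 0 * \<sigma>\<^sup>2)) =
      G \<omega> * ennreal (exp (- (wealth X t \<phi> \<omega> + \<beta> * R t \<omega> * (X t \<omega> - X 0 \<omega>)
        + \<beta>\<^sup>2 * real (T - t) / (2 * \<sigma>\<^sup>2) * (X 0 \<omega>)\<^sup>2)) *
        exp ((\<sigma>\<^sup>2 * ?w \<omega> - \<beta> * X 0 \<omega>)\<^sup>2 / (2 * \<sigma>\<^sup>2)))"
      by (simp only: exp_add[symmetric] mult_zero_left mult_zero_right add_0_left add_0_right
          mult_1_right div_by_1 real_sqrt_one)
  qed
  finally show ?thesis by (simp add: k_def)
qed

lemma initial_info_bound: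
  assumes \<phi>: "\<phi> \<in> strategies0 M X T" and G: "G \<in> borel_measurable (\<F> 0)"
  shows "(\<integral>\<^sup>+\<omega>. G \<omega> * ennreal (exp (- (\<beta>\<^sup>2 * (X 0 \<omega>)\<^sup>2 / (2 * \<sigma>\<^sup>2) * real T))) \<partial>M)
    \<le> (\<integral>\<^sup>+\<omega>. G \<omega> * ennreal (exp (- wealth X T \<phi> \<omega>)) \<partial>M)"
proof -
  define I where "I = (\<lambda>t. \<integral>\<^sup>+\<omega>. G \<omega> * ennreal (exp (- (wealth X t \<phi> \<omega>
    + \<beta> * discounted_tail T \<phi> t \<omega> * (X t \<omega> - X 0 \<omega>)
    + \<beta>\<^sup>2 * real (T - t) / (2 * \<sigma>\<^sup>2) * (X 0 \<omega>)\<^sup>2))) \<partial>M)"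
  have "I 0 \<le> I t" if "t \<le> T" for t
    using that
  proof (induction t)
    case (Suc t)
    have "I t \<le> I (Suc t)"
      unfolding I_def using Suc.prems
      by (subst initial_info_step[OF \<phi> G])
         (auto intro!: nn_integral_mono mult_left_mono ennreal_leI le_mult_exp)
    with Suc show ?case by simp
  qed simp
  from this[of T] show ?thesis
    by (simp add: I_def discounted_tail_def algebra_simps)
qed

text \<open>
  For \<open>eta_star\<close> the tail with \<open>k\<close> remaining periods equals \<open>k \<beta> X 0 / \<sigma>^2\<close>, so the exposure to each
  innovation is \<open>\<beta> X 0 / \<sigma>^2\<close>, the value at which the square vanishes.
\<close>
lemma initial_info_attained:
  assumes G: "G \<in> borel_measurable (\<F> 0)"
  shows "(\<integral>\<^sup>+\<omega>. G \<omega> * ennreal (exp (- (\<beta>\<^sup>2 * (X 0 \<omega>)\<^sup>2 / (2 * \<sigma>\<^sup>2) * real T))) \<partial>M)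
    = (\<integral>\<^sup>+\<omega>. G \<omega> * ennreal (exp (- wealth X T (eta_star \<beta> \<sigma> X T) \<omega>)) \<partial>M)"
proof -
  define \<phi> where "\<phi> = eta_star \<beta> \<sigma> X T"
  have tail: "discounted_tail T \<phi> (T - k) \<omega> = real k * \<beta> * X 0 \<omega> / \<sigma>\<^sup>2" if "k \<le> T" for k \<omega>
    using that
  proof (induction k)
    case 0
    show ?case by (simp add: discounted_tail_def)
  next
    case (Suc k)
    have \<alpha>: "\<alpha> = \<beta> + 1" using beta_def by simp
    have "discounted_tail T \<phi> (T - Suc k) \<omega> = \<phi> (T - k) \<omega> + \<alpha> * discounted_tail T \<phi> (T - k) \<omega>"
      using Suc.prems discounted_tail_rec[of "T - Suc k" T \<phi> \<omega>] by (simp add: Suc_diff_Suc)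
    also have "\<phi> (T - k) \<omega> = \<beta> * X 0 \<omega> / \<sigma>\<^sup>2 * (1 - real k * \<beta>)"
      using Suc.prems by (simp add: \<phi>_def eta_star_def phi_hat_def theta_def of_nat_diff)
    also have "discounted_tail T \<phi> (T - k) \<omega> = real k * \<beta> * X 0 \<omega> / \<sigma>\<^sup>2"
      using Suc by simp
    also have "\<beta> * X 0 \<omega> / \<sigma>\<^sup>2 * (1 - real k * \<beta>) + \<alpha> * (real k * \<beta> * X 0 \<omega> / \<sigma>\<^sup>2)
        = real (Suc k) * \<beta> * X 0 \<omega> / \<sigma>\<^sup>2"
      using sigma_pos unfolding \<alpha> by (simp add: field_simps)
    finally show ?case .
  qed
  define I where "I = (\<lambda>t. \<integral>\<^sup>+\<omega>. G \<omega> * ennreal (exp (- (wealth X t \<phi> \<omega>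
    + \<beta> * discounted_tail T \<phi> t \<omega> * (X t \<omega> - X 0 \<omega>)
    + \<beta>\<^sup>2 * real (T - t) / (2 * \<sigma>\<^sup>2) * (X 0 \<omega>)\<^sup>2))) \<partial>M)"
  have "I 0 = I t" if "t \<le> T" for t
    using that
  proof (induction t)
    case (Suc t)
    have "\<sigma>\<^sup>2 * (\<phi> (Suc t) \<omega> + \<beta> * discounted_tail T \<phi> (Suc t) \<omega>) = \<beta> * X 0 \<omega>" for \<omega>
    proof -
      have "\<phi> (Suc t) \<omega> = \<beta> * X 0 \<omega> / \<sigma>\<^sup>2 * (1 - real (T - Suc t) * \<beta>)"
        using Suc.prems by (simp add: \<phi>_def eta_star_def phi_hat_def theta_def of_nat_diff)
      moreover have "discounted_tail T \<phi> (Suc t) \<omega> = real (T - Suc t) * \<beta> * X 0 \<omega> / \<sigma>\<^sup>2"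
        using Suc.prems tail[of "T - Suc t" \<omega>] by simp
      ultimately show ?thesis
        using sigma_pos by (simp add: field_simps)
    qed
    hence "I t = I (Suc t)"
      unfolding I_def using Suc.prems
      by (subst initial_info_step[OF eta_star_strategy[of T, folded \<phi>_def] G]) auto
    with Suc show ?case by simp
  qed simp
  from this[of T] show ?thesis
    by (simp add: I_def discounted_tail_def[of T _ T] algebra_simps \<phi>_def)
qed

end

section \<open>From integral bounds to conditional optimality\<close>

context gaussian_ar1
begin

lemma ext_expectation_utility:
  "ext_expectation M (\<lambda>\<omega>. U (Y \<omega>)) = - enn2ereal (\<integral>\<^sup>+\<omega>. ennreal (exp (- Y \<omega>)) \<partial>M)"
proof -
  have "(\<integral>\<^sup>+\<omega>. ennreal (U (Y \<omega>)) \<partial>M) = 0"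
    by (simp add: U_def ennreal_neg)
  thus ?thesis
    by (simp add: ext_expectation_def U_def zero_ennreal.rep_eq)
qed

lemma X0_sigma_algebra:
  "finite_measure_subalgebra M (vimage_algebra (space M) (X 0) borel)"
proof
  show "subalgebra M (vimage_algebra (space M) (X 0) borel)"
    using filtration_subalgebra[of 0] by (simp add: subalgebra_def sets_filtration_0)
qed

text \<open>
  Utility is negative, so the positive part contributes nothing and the extended conditional
  expectation reduces to a nonnegative one.
\<close>
lemma ext_cond_exp_utility:
  "AE \<omega> in M. ext_cond_exp M (X 0) (\<lambda>\<omega>. U (Y \<omega>)) \<omega> =
     - enn2ereal (nn_cond_exp M (vimage_algebra (space M) (X 0) borel) (\<lambda>\<omega>. ennreal (exp (- Y \<omega>))) \<omega>)"
proof -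
  interpret S: finite_measure_subalgebra M "vimage_algebra (space M) (X 0) borel"
    by (rule X0_sigma_algebra)
  have "AE \<omega> in M. (0::ennreal) = nn_cond_exp M (vimage_algebra (space M) (X 0) borel) (\<lambda>\<omega>. 0) \<omega>"
    by (rule S.nn_cond_exp_F_meas) simp
  thus ?thesis
  proof eventually_elim
    case (elim \<omega>)
    thus ?case
      by (simp add: ext_cond_exp_def U_def ennreal_neg zero_ennreal.rep_eq flip: elim)
  qed
qed

end

text \<open>
  A class \<open>S\<close> of strategies whose expected disutility is bounded below by \<open>v (X 0)\<close> under every
  weight depending on the initial price, with equality for \<open>\<phi>\<^sub>0\<close>. Both the problem with past
  information and the one with initial information are instances.
\<close>
locale attained_value = gaussian_ar1 +
  fixes T :: nat and S :: "(nat \<Rightarrow> 'a \<Rightarrow> real) set" and \<phi>\<^sub>0 :: "nat \<Rightarrow> 'a \<Rightarrow> real" and v :: "real \<Rightarrow> real"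
  assumes S: "S \<subseteq> strategies M X" and opt_in_S: "\<phi>\<^sub>0 \<in> S"
    and v_measurable: "v \<in> borel_measurable borel" and v_range: "0 \<le> v z" "v z \<le> 1"
    and bound: "\<phi> \<in> S \<Longrightarrow> G \<in> borel_measurable (\<F> 0) \<Longrightarrow>
      (\<integral>\<^sup>+\<omega>. G \<omega> * ennreal (v (X 0 \<omega>)) \<partial>M) \<le> (\<integral>\<^sup>+\<omega>. G \<omega> * ennreal (exp (- wealth X T \<phi> \<omega>)) \<partial>M)"
    and attained: "G \<in> borel_measurable (\<F> 0) \<Longrightarrow>
      (\<integral>\<^sup>+\<omega>. G \<omega> * ennreal (v (X 0 \<omega>)) \<partial>M) = (\<integral>\<^sup>+\<omega>. G \<omega> * ennreal (exp (- wealth X T \<phi>\<^sub>0 \<omega>)) \<partial>M)"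
begin

abbreviation "\<G> \<equiv> vimage_algebra (space M) (X 0) borel"

lemma value_expectation:
  "ext_expectation M (\<lambda>\<omega>. U (wealth X T \<phi>\<^sub>0 \<omega>)) = - enn2ereal (\<integral>\<^sup>+\<omega>. ennreal (v (X 0 \<omega>)) \<partial>M)"
  using attained[of "\<lambda>_. 1"] by (simp add: ext_expectation_utility)

lemma value_SUP:
  "(SUP \<phi>\<in>S. ext_expectation M (\<lambda>\<omega>. U (wealth X T \<phi> \<omega>)))
    = ext_expectation M (\<lambda>\<omega>. U (wealth X T \<phi>\<^sub>0 \<omega>))"
proof (rule antisym)
  show "(SUP \<phi>\<in>S. ext_expectation M (\<lambda>\<omega>. U (wealth X T \<phi> \<omega>)))
      \<le> ext_expectation M (\<lambda>\<omega>. U (wealth X T \<phi>\<^sub>0 \<omega>))"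
  proof (rule SUP_least)
    fix \<phi> assume "\<phi> \<in> S"
    from bound[OF this, of "\<lambda>_. 1"]
    show "ext_expectation M (\<lambda>\<omega>. U (wealth X T \<phi> \<omega>)) \<le> ext_expectation M (\<lambda>\<omega>. U (wealth X T \<phi>\<^sub>0 \<omega>))"
      unfolding value_expectation by (simp add: ext_expectation_utility less_eq_ennreal.rep_eq)
  qed
qed (rule SUP_upper[OF opt_in_S])

lemma measurable_\<G>: "G \<in> borel_measurable \<G> \<Longrightarrow> G \<in> borel_measurable (\<F> 0)"
  using measurable_cong_sets[OF sets_filtration_0 refl] by blast

lemma v_X0_measurable: "(\<lambda>\<omega>. ennreal (v (X 0 \<omega>))) \<in> borel_measurable \<G>"
proof -
  have "X 0 \<in> borel_measurable \<G>"
    by (rule measurable_vimage_algebra1) simp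
  from measurable_compose[OF this v_measurable] show ?thesis by simp
qed

lemma value_cond_exp:
  "AE \<omega> in M. ext_cond_exp M (X 0) (\<lambda>\<omega>. U (wealth X T \<phi>\<^sub>0 \<omega>)) \<omega> = ereal (- v (X 0 \<omega>))"
proof -
  interpret S: finite_measure_subalgebra M \<G> by (rule X0_sigma_algebra)
  have "AE \<omega> in M. ennreal (v (X 0 \<omega>)) = nn_cond_exp M \<G> (\<lambda>\<omega>. ennreal (exp (- wealth X T \<phi>\<^sub>0 \<omega>))) \<omega>"
  proof (rule S.nn_cond_exp_charact)
    fix A assume "A \<in> sets \<G>"
    thus "(\<integral>\<^sup>+\<omega>\<in>A. ennreal (exp (- wealth X T \<phi>\<^sub>0 \<omega>)) \<partial>M) = (\<integral>\<^sup>+\<omega>\<in>A. ennreal (v (X 0 \<omega>)) \<partial>M)"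
      using attained[of "indicator A"] by (simp add: measurable_\<G> mult.commute)
  qed (use wealth_measurable[of \<phi>\<^sub>0 T] S opt_in_S v_X0_measurable in auto)
  with ext_cond_exp_utility[of "wealth X T \<phi>\<^sub>0"] show ?thesis
  proof eventually_elim
    case (elim \<omega>)
    show ?case
      unfolding elim(1) elim(2)[symmetric] using v_range by simp
  qed
qed

lemma value_cond_exp_le:
  assumes "\<phi> \<in> S"
  shows "AE \<omega> in M. ext_cond_exp M (X 0) (\<lambda>\<omega>. U (wealth X T \<phi> \<omega>)) \<omega>
    \<le> ext_cond_exp M (X 0) (\<lambda>\<omega>. U (wealth X T \<phi>\<^sub>0 \<omega>)) \<omega>"
proof -
  interpret S: finite_measure_subalgebra M \<G> by (rule X0_sigma_algebra)
  have "AE \<omega> in M. ennreal (v (X 0 \<omega>)) \<le> nn_cond_exp M \<G> (\<lambda>\<omega>. ennreal (exp (- wealth X T \<phi> \<omega>))) \<omega>"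
  proof (rule S.nn_cond_exp_ge)
    have "(\<integral>\<^sup>+\<omega>. ennreal (v (X 0 \<omega>)) \<partial>M) \<le> (\<integral>\<^sup>+\<omega>. 1 \<partial>M)"
      using v_range by (intro nn_integral_mono) simp
    also have "\<dots> < \<infinity>" by (simp add: emeasure_space_1)
    finally show "(\<integral>\<^sup>+\<omega>. ennreal (v (X 0 \<omega>)) \<partial>M) < \<infinity>" .
  next
    fix A assume "A \<in> sets \<G>"
    thus "(\<integral>\<^sup>+\<omega>\<in>A. ennreal (v (X 0 \<omega>)) \<partial>M) \<le> (\<integral>\<^sup>+\<omega>\<in>A. ennreal (exp (- wealth X T \<phi> \<omega>)) \<partial>M)"
      using bound[OF assms, of "indicator A"] by (simp add: measurable_\<G> mult.commute)
  qed (use wealth_measurable[of \<phi> T] S assms v_X0_measurable in auto)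
  with ext_cond_exp_utility[of "wealth X T \<phi>"] value_cond_exp show ?thesis
  proof eventually_elim
    case (elim \<omega>)
    from elim(3) have "enn2ereal (ennreal (v (X 0 \<omega>))) \<le>
        enn2ereal (nn_cond_exp M \<G> (\<lambda>\<omega>. ennreal (exp (- wealth X T \<phi> \<omega>))) \<omega>)"
      by (simp add: less_eq_ennreal.rep_eq)
    hence "ereal (v (X 0 \<omega>)) \<le>
        enn2ereal (nn_cond_exp M \<G> (\<lambda>\<omega>. ennreal (exp (- wealth X T \<phi> \<omega>))) \<omega>)"
      using v_range by simp
    thus ?case
      unfolding elim(1) elim(2) by (metis ereal_minus_le_minus uminus_ereal.simps(1))
  qed
qed

text \<open>
  The version chosen by \<open>ext_cond_exp_at\<close> composed with \<open>X 0\<close> agrees almost surely with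
  \<open>- v (X 0)\<close>, hence the two functions agree almost everywhere for the law of \<open>X 0\<close>.
\<close>
lemma value_cond_exp_at:
  "AE z in distr M borel (X 0). ext_cond_exp_at M (X 0) (\<lambda>\<omega>. U (wealth X T \<phi>\<^sub>0 \<omega>)) z = ereal (- v z)"
proof -
  let ?Y = "\<lambda>\<omega>. U (wealth X T \<phi>\<^sub>0 \<omega>)"
  define g where "g = ext_cond_exp_at M (X 0) ?Y"
  note [measurable] = v_measurable
  have "\<exists>g. g \<in> borel_measurable borel \<and> (AE \<omega> in M. g (X 0 \<omega>) = ext_cond_exp M (X 0) ?Y \<omega>)"
    using value_cond_exp by (intro exI[of _ "\<lambda>z. ereal (- v z)"]) (auto elim: eventually_mono)
  from someI_ex[OF this] have g[measurable]: "g \<in> borel_measurable borel"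
    and g_eq: "AE \<omega> in M. g (X 0 \<omega>) = ext_cond_exp M (X 0) ?Y \<omega>"
    unfolding g_def ext_cond_exp_at_def by blast+
  from g_eq value_cond_exp have "AE \<omega> in M. g (X 0 \<omega>) = ereal (- v (X 0 \<omega>))"
    by eventually_elim simp
  thus ?thesis
    unfolding g_def[symmetric] by (subst AE_distr_iff) measurable
qed

end

section \<open>Stationary start\<close>

context gaussian_ar1
begin

lemma risk_factor_gamma: "risk_factor k = 1 / sqrt (gamma_beta \<beta> k)"
  by (induction k) (simp_all add: risk_factor_def gamma_beta_prod real_sqrt_mult)

lemma risk_factor_le_1: "risk_factor k \<le> 1"
  unfolding risk_factor_def by (intro prod_le_1) (simp add: add_pos_nonneg)

lemma std_normal_moments:
  assumes "distributed M lborel Z (\<lambda>x. ennreal (std_normal_density x))"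
  shows "integrable M Z" and "integrable M (\<lambda>\<omega>. (Z \<omega>)\<^sup>2)"
    and "expectation Z = 0" and "expectation (\<lambda>\<omega>. (Z \<omega>)\<^sup>2) = 1"
proof -
  show "integrable M Z"
    using distributed_integrable[OF assms, of "\<lambda>x. x"] integrable_std_normal_moment[of 1] by simp
  show "integrable M (\<lambda>\<omega>. (Z \<omega>)\<^sup>2)"
    using distributed_integrable[OF assms, of "\<lambda>x. x\<^sup>2"] integrable_std_normal_moment[of 2] by simp
  show E: "expectation Z = 0"
    by (rule standard_normal_distributed_expectation[OF assms])
  show "expectation (\<lambda>\<omega>. (Z \<omega>)\<^sup>2) = 1"
    using standard_normal_distributed_variance[OF assms] E by simp
qed

lemma indep_X0_first_noise: "indep_var borel (X 0) borel (\<epsilon> 1)"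
proof -
  have "sigma_sets (space M) {\<epsilon> 1 -` A \<inter> space M |A. A \<in> sets borel} = {\<epsilon> 1 -` A \<inter> space M |A. A \<in> sets borel}"
    using sets_vimage_algebra[of "space M" "\<epsilon> 1" borel] sets_vimage_algebra2[of "\<epsilon> 1" "space M" borel] by simp
  moreover have "sigma_sets (space M) {X 0 -` A \<inter> space M |A. A \<in> sets borel} = sets (\<F> 0)"
    by (simp add: sets_filtration)
  moreover have "sets (\<F> 0) \<subseteq> events"
    using filtration_subalgebra by (simp add: subalgebra_def)
  ultimately show ?thesis
    unfolding indep_var_eq indep_sets2_eq
    using X_measurable noise_measurable[of 1] indep_past_next_noise[of _ 0]
    by (auto intro: measurable_sets)
qed

text \<open>
  Unit variance at times zero and one already pins down \<open>\<sigma>\<close>, because the recursion gives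
  \<open>\<alpha>^2 + \<sigma>^2\<close> as the variance of \<open>X 1\<close>.
\<close>
lemma stationary_noise_variance:
  assumes X0: "distributed M lborel (X 0) (\<lambda>x. ennreal (std_normal_density x))"
    and var: "variance (X 1) = 1"
  shows "\<sigma>\<^sup>2 = - \<beta> * (\<beta> + 2)"
proof -
  note mX = std_normal_moments[OF X0] and m\<epsilon> = std_normal_moments[OF noise_normal[of 1, simplified]]
  have cross: "integrable M (\<lambda>\<omega>. X 0 \<omega> * \<epsilon> 1 \<omega>)" "expectation (\<lambda>\<omega>. X 0 \<omega> * \<epsilon> 1 \<omega>) = 0"
    using indep_var_integrable[OF indep_X0_first_noise] indep_var_lebesgue_integral[OF indep_X0_first_noise] mX m\<epsilon>
    by simp_all
  have X1: "X 1 \<omega> = \<alpha> * X 0 \<omega> + \<sigma> * \<epsilon> 1 \<omega>" if "\<omega> \<in> space M" for \<omega>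
    using X_Suc[OF that, of 0] by simp
  have "expectation (X 1) = expectation (\<lambda>\<omega>. \<alpha> * X 0 \<omega> + \<sigma> * \<epsilon> 1 \<omega>)"
    by (intro Bochner_Integration.integral_cong X1 refl)
  also have "\<dots> = 0"
    using mX m\<epsilon> by simp
  finally have "variance (X 1) = expectation (\<lambda>\<omega>. (X 1 \<omega>)\<^sup>2)" by simp
  also have "\<dots> = expectation (\<lambda>\<omega>. \<alpha>\<^sup>2 * (X 0 \<omega>)\<^sup>2 + 2 * \<alpha> * \<sigma> * (X 0 \<omega> * \<epsilon> 1 \<omega>) + \<sigma>\<^sup>2 * (\<epsilon> 1 \<omega>)\<^sup>2)"
    by (intro Bochner_Integration.integral_cong refl) (simp add: X1[simplified] power2_eq_square algebra_simps)
  also have "\<dots> = \<alpha>\<^sup>2 + \<sigma>\<^sup>2"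
    using mX m\<epsilon> cross by simp
  finally have "\<alpha>\<^sup>2 + \<sigma>\<^sup>2 = 1" using var by simp
  moreover have "\<alpha> = \<beta> + 1" using beta_def by simp
  ultimately show ?thesis by (simp add: power2_eq_square algebra_simps)
qed

lemma expectation_gaussian_value:
  assumes X0: "distributed M lborel (X 0) (\<lambda>x. ennreal (std_normal_density x))" and K: "K \<ge> 0"
  shows "(\<integral>\<^sup>+\<omega>. ennreal (K * exp (- (\<beta>\<^sup>2 * (X 0 \<omega>)\<^sup>2 / (2 * \<sigma>\<^sup>2) * real T))) \<partial>M)
    = ennreal (K / sqrt (1 + \<beta>\<^sup>2 * real T / \<sigma>\<^sup>2))"
proof -
  define a where "a = \<beta>\<^sup>2 * real T / (2 * \<sigma>\<^sup>2)"
  have "(\<integral>\<^sup>+\<omega>. ennreal (K * exp (- (\<beta>\<^sup>2 * (X 0 \<omega>)\<^sup>2 / (2 * \<sigma>\<^sup>2) * real T))) \<partial>M)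
      = (\<integral>\<^sup>+\<omega>. ennreal K * ennreal (exp (- (a * (X 0 \<omega>)\<^sup>2 + 0 * X 0 \<omega> + 0))) \<partial>M)"
    using K by (intro nn_integral_cong) (simp add: a_def ac_simps flip: ennreal_mult)
  also have "\<dots> = (\<integral>\<^sup>+y. ennreal (std_normal_density y) * (ennreal K * ennreal (exp (- (a * y\<^sup>2 + 0 * y + 0)))) \<partial>lborel)"
    by (rule distributed_nn_integral[OF X0, symmetric]) measurable
  also have "\<dots> = ennreal K * (\<integral>\<^sup>+y. ennreal (exp (- (a * y\<^sup>2 + 0 * y + 0))) * ennreal (std_normal_density y) \<partial>lborel)"
    by (subst nn_integral_cmult[symmetric]) (auto intro!: nn_integral_cong simp: ac_simps)
  also have "\<dots> = ennreal (K / sqrt (1 + \<beta>\<^sup>2 * real T / \<sigma>\<^sup>2))"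
    using K by (subst nn_integral_std_normal_exp_quadratic) (simp_all add: a_def flip: ennreal_mult)
  finally show ?thesis .
qed

end

section \<open>The optimal strategies and their values\<close>

theorem theorem2p1:
  fixes M :: "'a measure" and X \<epsilon> :: "nat \<Rightarrow> 'a \<Rightarrow> real"
    and \<alpha> \<beta> \<sigma> :: real and T :: nat
  assumes "prob_space M"
    and "\<sigma> > 0"
    and "\<beta> = \<alpha> - 1"
    and "X 0 \<in> borel_measurable M"
    and "\<And>t. t \<ge> 1 \<Longrightarrow> distributed M lborel (\<epsilon> t) (\<lambda>x. ennreal (std_normal_density x))"
    and "prob_space.indep_vars M (\<lambda>_. borel) \<epsilon> {1..}"
    and "prob_space.indep_set M (sets (vimage_algebra (space M) (X 0) borel))
           (sets (vimage_algebra (space M) (\<lambda>\<omega>. \<lambda>t\<in>{1..}. \<epsilon> t \<omega>) (Pi\<^sub>M {1..} (\<lambda>_. borel))))"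
    and "\<And>t \<omega>. \<omega> \<in> space M \<Longrightarrow> X (Suc t) \<omega> = \<alpha> * X t \<omega> + \<sigma> * \<epsilon> (Suc t) \<omega>"
    and "T \<ge> 1"
  shows
    "(phi_star \<beta> \<sigma> X T \<in> strategies M X
      \<and> (SUP \<phi>\<in>strategies M X. ext_expectation M (\<lambda>\<omega>. U (wealth X T \<phi> \<omega>)))
          = ext_expectation M (\<lambda>\<omega>. U (wealth X T (phi_star \<beta> \<sigma> X T) \<omega>))
      \<and> eta_star \<beta> \<sigma> X T \<in> strategies0 M X T
      \<and> (SUP \<phi>\<in>strategies0 M X T. ext_expectation M (\<lambda>\<omega>. U (wealth X T \<phi> \<omega>)))
          = ext_expectation M (\<lambda>\<omega>. U (wealth X T (eta_star \<beta> \<sigma> X T) \<omega>)))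
   \<and> ((\<forall>\<phi>\<in>strategies M X. AE \<omega> in M.
           ext_cond_exp M (X 0) (\<lambda>\<omega>. U (wealth X T \<phi> \<omega>)) \<omega>
         \<le> ext_cond_exp M (X 0) (\<lambda>\<omega>. U (wealth X T (phi_star \<beta> \<sigma> X T) \<omega>)) \<omega>)
      \<and> (\<forall>\<phi>\<in>strategies0 M X T. AE \<omega> in M.
           ext_cond_exp M (X 0) (\<lambda>\<omega>. U (wealth X T \<phi> \<omega>)) \<omega>
         \<le> ext_cond_exp M (X 0) (\<lambda>\<omega>. U (wealth X T (eta_star \<beta> \<sigma> X T) \<omega>)) \<omega>)
      \<and> (AE z in distr M borel (X 0).
           ext_cond_exp_at M (X 0) (\<lambda>\<omega>. U (wealth X T (phi_star \<beta> \<sigma> X T) \<omega>)) z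
         = ereal (- (1 / sqrt (gamma_beta \<beta> T)) * exp (- (\<beta>\<^sup>2 * z\<^sup>2 / (2 * \<sigma>\<^sup>2) * real T))))
      \<and> (AE z in distr M borel (X 0).
           ext_cond_exp_at M (X 0) (\<lambda>\<omega>. U (wealth X T (eta_star \<beta> \<sigma> X T) \<omega>)) z
         = ereal (- exp (- (\<beta>\<^sup>2 * z\<^sup>2 / (2 * \<sigma>\<^sup>2) * real T)))))
   \<and> ((\<bar>\<alpha>\<bar> < 1 \<longleftrightarrow> \<beta> \<in> {-2<..<0})
      \<and> (\<bar>\<alpha>\<bar> < 1
         \<and> distributed M lborel (X 0) (\<lambda>x. ennreal (std_normal_density x))
         \<and> (\<forall>t. prob_space.variance M (X t) = 1)
         \<longrightarrow> ext_expectation M (\<lambda>\<omega>. U (wealth X T (phi_star \<beta> \<sigma> X T) \<omega>))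
               = ereal (- sqrt ((\<beta> + 2) / ((2 - (real T - 1) * \<beta>) * gamma_beta \<beta> T)))
           \<and> ext_expectation M (\<lambda>\<omega>. U (wealth X T (eta_star \<beta> \<sigma> X T) \<omega>))
               = ereal (- sqrt ((\<beta> + 2) / (2 - (real T - 1) * \<beta>)))))
   \<and> (\<lambda>n. gamma_beta \<beta> n / h_beta \<beta> n) \<longlonglongrightarrow> 1"
proof -
  interpret gaussian_ar1 M X \<epsilon> \<alpha> \<beta> \<sigma>
    using assms(1-8) by (intro gaussian_ar1.intro gaussian_ar1_axioms.intro) auto
  \<comment> \<open>The conditional disutilities of the two optimal strategies given that the price starts at z.\<close>
  define v where "v z = risk_factor T * exp (- (\<beta>\<^sup>2 * z\<^sup>2 / (2 * \<sigma>\<^sup>2) * real T))" for z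
  define v0 where "v0 z = exp (- (\<beta>\<^sup>2 * z\<^sup>2 / (2 * \<sigma>\<^sup>2) * real T))" for z
  have v0_le: "v0 z \<le> 1" for z by (simp add: v0_def)
  have "v z = risk_factor T * v0 z" for z by (simp add: v_def v0_def)
  hence v_le: "v z \<le> 1" for z
    using mult_le_one[OF risk_factor_le_1 _ v0_le] by (simp add: v0_def)
  have v_ge: "v z \<ge> 0" and v0_ge: "v0 z \<ge> 0" for z
    by (simp_all add: v_def v0_def risk_factor_nonneg)
  have v_borel: "v \<in> borel_measurable borel" "v0 \<in> borel_measurable borel"
    unfolding v_def[abs_def] v0_def[abs_def] by measurable
  interpret past: attained_value M X \<epsilon> \<alpha> \<beta> \<sigma> T "strategies M X" "phi_star \<beta> \<sigma> X T" v
  proof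
    show "(\<integral>\<^sup>+\<omega>. G \<omega> * ennreal (v (X 0 \<omega>)) \<partial>M)
        \<le> (\<integral>\<^sup>+\<omega>. G \<omega> * ennreal (exp (- wealth X T \<phi> \<omega>)) \<partial>M)"
      if "\<phi> \<in> strategies M X" "G \<in> borel_measurable (\<F> 0)" for \<phi> G
      unfolding v_def by (rule past_info_bound[OF that])
    show "(\<integral>\<^sup>+\<omega>. G \<omega> * ennreal (v (X 0 \<omega>)) \<partial>M)
        = (\<integral>\<^sup>+\<omega>. G \<omega> * ennreal (exp (- wealth X T (phi_star \<beta> \<sigma> X T) \<omega>)) \<partial>M)"
      if "G \<in> borel_measurable (\<F> 0)" for G
      unfolding v_def by (rule past_info_attained[OF that])
  qed (rule subset_refl phi_star_strategy v_borel v_ge v_le)+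
  interpret initial: attained_value M X \<epsilon> \<alpha> \<beta> \<sigma> T "strategies0 M X T" "eta_star \<beta> \<sigma> X T" v0
  proof
    show "strategies0 M X T \<subseteq> strategies M X"
      by (auto simp: strategies0_def)
    show "(\<integral>\<^sup>+\<omega>. G \<omega> * ennreal (v0 (X 0 \<omega>)) \<partial>M)
        \<le> (\<integral>\<^sup>+\<omega>. G \<omega> * ennreal (exp (- wealth X T \<phi> \<omega>)) \<partial>M)"
      if "\<phi> \<in> strategies0 M X T" "G \<in> borel_measurable (\<F> 0)" for \<phi> G
      unfolding v0_def by (rule initial_info_bound[OF that])
    show "(\<integral>\<^sup>+\<omega>. G \<omega> * ennreal (v0 (X 0 \<omega>)) \<partial>M)
        = (\<integral>\<^sup>+\<omega>. G \<omega> * ennreal (exp (- wealth X T (eta_star \<beta> \<sigma> X T) \<omega>)) \<partial>M)"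
      if "G \<in> borel_measurable (\<F> 0)" for G
      unfolding v0_def by (rule initial_info_attained[OF that])
  qed (rule eta_star_strategy v_borel v0_ge v0_le)+
  have stable: "\<bar>\<alpha>\<bar> < 1 \<longleftrightarrow> \<beta> \<in> {-2<..<0}"
    using assms(3) by auto
  have stationary: "ext_expectation M (\<lambda>\<omega>. U (wealth X T (phi_star \<beta> \<sigma> X T) \<omega>))
         = ereal (- sqrt ((\<beta> + 2) / ((2 - (real T - 1) * \<beta>) * gamma_beta \<beta> T)))"
      "ext_expectation M (\<lambda>\<omega>. U (wealth X T (eta_star \<beta> \<sigma> X T) \<omega>))
         = ereal (- sqrt ((\<beta> + 2) / (2 - (real T - 1) * \<beta>)))"
    if \<alpha>: "\<bar>\<alpha>\<bar> < 1" and X0: "distributed M lborel (X 0) (\<lambda>x. ennreal (std_normal_density x))"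
      and var: "\<forall>t. variance (X t) = 1"
  proof -
    have \<beta>: "-2 < \<beta>" "\<beta> < 0" using \<alpha> stable by auto
    have \<sigma>2: "\<sigma>\<^sup>2 = - \<beta> * (\<beta> + 2)"
      using stationary_noise_variance[OF X0] var by blast
    have "1 + \<beta>\<^sup>2 * real T / \<sigma>\<^sup>2 = (2 - (real T - 1) * \<beta>) / (\<beta> + 2)"
    proof -
      have "\<beta>\<^sup>2 * real T / (- \<beta> * (\<beta> + 2)) = - (\<beta> * real T / (\<beta> + 2))"
        using \<beta> by (simp add: power2_eq_square)
      thus ?thesis
        unfolding \<sigma>2 using \<beta> by (simp add: field_simps)
    qed
    hence scale: "1 / sqrt (1 + \<beta>\<^sup>2 * real T / \<sigma>\<^sup>2) = sqrt ((\<beta> + 2) / (2 - (real T - 1) * \<beta>))"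
      by (simp add: real_sqrt_divide)
    have "risk_factor T / sqrt (1 + \<beta>\<^sup>2 * real T / \<sigma>\<^sup>2)
        = 1 / sqrt (1 + \<beta>\<^sup>2 * real T / \<sigma>\<^sup>2) * (1 / sqrt (gamma_beta \<beta> T))"
      by (simp add: risk_factor_gamma)
    also have "\<dots> = sqrt ((\<beta> + 2) / ((2 - (real T - 1) * \<beta>) * gamma_beta \<beta> T))"
      unfolding scale by (simp add: real_sqrt_mult real_sqrt_divide)
    finally have gamma_scale: "risk_factor T / sqrt (1 + \<beta>\<^sup>2 * real T / \<sigma>\<^sup>2)
        = sqrt ((\<beta> + 2) / ((2 - (real T - 1) * \<beta>) * gamma_beta \<beta> T))" .
    have "0 \<le> risk_factor T / sqrt (1 + \<beta>\<^sup>2 * real T / \<sigma>\<^sup>2)"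
      by (simp add: risk_factor_nonneg)
    thus "ext_expectation M (\<lambda>\<omega>. U (wealth X T (phi_star \<beta> \<sigma> X T) \<omega>))
         = ereal (- sqrt ((\<beta> + 2) / ((2 - (real T - 1) * \<beta>) * gamma_beta \<beta> T)))"
      unfolding past.value_expectation unfolding v_def
        expectation_gaussian_value[OF X0 risk_factor_nonneg] gamma_scale
      by (simp only: enn2ereal_ennreal uminus_ereal.simps)
    have "0 \<le> sqrt ((\<beta> + 2) / (2 - (real T - 1) * \<beta>))"
      unfolding scale[symmetric] by simp
    thus "ext_expectation M (\<lambda>\<omega>. U (wealth X T (eta_star \<beta> \<sigma> X T) \<omega>))
         = ereal (- sqrt ((\<beta> + 2) / (2 - (real T - 1) * \<beta>)))"
      unfolding initial.value_expectation unfolding v0_def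
        expectation_gaussian_value[OF X0 zero_le_one, unfolded mult_1_left] scale
      by (simp only: enn2ereal_ennreal uminus_ereal.simps)
  qed
  show ?thesis
    using phi_star_strategy eta_star_strategy past.value_SUP initial.value_SUP
      past.value_cond_exp_le initial.value_cond_exp_le
      past.value_cond_exp_at initial.value_cond_exp_at
      stable stationary gamma_beta_asymptotics[of \<beta>]
    by (simp only: v_def v0_def risk_factor_gamma minus_mult_left simp_thms ball_simps) blast
qed

end
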